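(* Fix $D\ge1$, let $(r_n)$ be a sequence in $[0,1/2]$, and suppose that $n^2r_n^D\to a\in[0,\infty)$ as $n\to\infty$. Put $\lambda=2^{D-1}a$. For every first-order graph sentence $\varphi$, the limit $$\lim_{n\to\infty}\mathbb P(G_D(n;r_n)\models\varphi)$$ exists. More precisely, for each $j\ge0$, let $b_\varphi(j)\in\{0,1\}$ be the eventual truth value of $\varphi$ on $M(j,N)$ as $N\to\infty$ (the truth value of $\varphi$ on $M(j,N)$ is constant for all sufficiently large $N$). Then $$\lim_{n\to\infty}\mathbb P(G_D(n;r_n)\models\varphi)=\sum_{j=0}^{\infty}e^{-\lambda}\frac{\lambda^j}{j!}\,b_\varphi(j).$$ In particular, if $a=0$, then $G_D(n;r_n)$ is empty (has no edges) with high probability and the first-order zero-one law holds. If $a\in(0,\infty)$, then the first-order zero-one law fails.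
   Context: Let $\mathbb T^D=(\mathbb R/\mathbb Z)^D$, with torus $L^\infty$ metric $d_\infty(x,y)=\max_{1\le i\le D}\|x_i-y_i\|_{\mathbb T}$, where $\|t\|_{\mathbb T}=\min_{m\in\mathbb Z}|t-m|$. Let $X_1,\dots,X_n$ be independent uniform random points of $\mathbb T^D$. For $0\le r\le1/2$, $G_D(n;r)$ is the simple graph on $[n]=\{1,\dots,n\}$ in which distinct $i,j$ are adjacent iff $d_\infty(X_i,X_j)\le r$. For integers $j,N\ge0$, $M(j,N)$ is the graph consisting of $j$ disjoint edges and $N$ isolated vertices. Graphs are finite, simple, undirected, and regarded as structures in the first-order language with equality and one binary relation symbol $E$. A sequence of random graphs satisfies a first-order zero-one law if, for every first-order graph sentence, the probability that the sentence holds tends to either $0$ or $1$ as $n\to\infty$. "With high probability" means with probability tending to $1$ as $n\to\infty$. *)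

theory Defs
  imports "HOL-Probability.Probability"
begin

section \<open>The torus and its uniform measure\<close>

quotient_type circle = real / "\<lambda>x y::real. \<exists>m::int. x - y = of_int m"
proof (rule equivpI)
  show "reflp (\<lambda>x y::real. \<exists>m::int. x - y = of_int m)"
    by (rule reflpI, rule exI[of _ 0]) simp
  show "symp (\<lambda>x y::real. \<exists>m::int. x - y = of_int m)"
  proof (rule sympI)
    fix x y :: real
    assume "\<exists>m::int. x - y = of_int m"
    then obtain m :: int where "x - y = of_int m" ..
    then have "y - x = of_int (- m)" by simp
    then show "\<exists>m::int. y - x = of_int m" ..
  qed
  show "transp (\<lambda>x y::real. \<exists>m::int. x - y = of_int m)"
  proof (rule transpI)
    fix x y z :: real
    assume "\<exists>m::int. x - y = of_int m" "\<exists>m::int. y - z = of_int m"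
    then obtain m k :: int where "x - y = of_int m" "y - z = of_int k" by blast
    then have "x - z = of_int (m + k)" by simp
    then show "\<exists>m::int. x - z = of_int m" ..
  qed
qed

instantiation circle :: ab_group_add
begin

lift_definition zero_circle :: circle is 0 .

lift_definition plus_circle :: "circle \<Rightarrow> circle \<Rightarrow> circle" is "(+)"
proof -
  fix x x' y y' :: real
  assume "\<exists>m::int. x - x' = of_int m" "\<exists>m::int. y - y' = of_int m"
  then obtain m k :: int where "x - x' = of_int m" "y - y' = of_int k" by blast
  then have "(x + y) - (x' + y') = of_int (m + k)" by simp
  then show "\<exists>m::int. (x + y) - (x' + y') = of_int m" ..
qed

lift_definition uminus_circle :: "circle \<Rightarrow> circle" is uminus
proof -
  fix x x' :: real
  assume "\<exists>m::int. x - x' = of_int m"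
  then obtain m :: int where "x - x' = of_int m" ..
  then have "- x - (- x') = of_int (- m)" by simp
  then show "\<exists>m::int. - x - (- x') = of_int m" ..
qed

definition minus_circle :: "circle \<Rightarrow> circle \<Rightarrow> circle" where
  "minus_circle x y = x + (- y)"

instance
proof
  fix a b c :: circle
  show "a + b + c = a + (b + c)"
    by transfer (rule exI[of _ 0], simp)
  show "a + b = b + a"
    by transfer (rule exI[of _ 0], simp)
  show "0 + a = a"
    by transfer (rule exI[of _ 0], simp)
  show "- a + a = 0"
    by transfer (rule exI[of _ 0], simp)
  show "a - b = a + - b"
    by (rule minus_circle_def)
qed

end

lift_definition circle_norm :: "circle \<Rightarrow> real" is "\<lambda>t. INF m::int. \<bar>t - of_int m\<bar>"
proof -
  fix s t :: real
  assume "\<exists>m::int. s - t = of_int m"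
  then obtain k :: int where k: "s - t = of_int k" ..
  have "range (\<lambda>m::int. \<bar>s - of_int m\<bar>) = range (\<lambda>m::int. \<bar>t - of_int m\<bar>)"
  proof (intro equalityI subsetI)
    fix u assume "u \<in> range (\<lambda>m::int. \<bar>s - of_int m\<bar>)"
    then obtain m :: int where "u = \<bar>s - of_int m\<bar>" by blast
    also have "s - of_int m = t - of_int (m - k)" using k by simp
    finally show "u \<in> range (\<lambda>m::int. \<bar>t - of_int m\<bar>)" by blast
  next
    fix u assume "u \<in> range (\<lambda>m::int. \<bar>t - of_int m\<bar>)"
    then obtain m :: int where "u = \<bar>t - of_int m\<bar>" by blast
    also have "t - of_int m = s - of_int (m + k)" using k by simp
    finally show "u \<in> range (\<lambda>m::int. \<bar>s - of_int m\<bar>)" by blast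
  qed
  then show "(INF m::int. \<bar>s - of_int m\<bar>) = (INF m::int. \<bar>t - of_int m\<bar>)"
    by simp
qed

text \<open>The infimum defining the norm is a minimum.\<close>

lemma circle_norm_attained:
  "\<exists>m::int. circle_norm (abs_circle t) = \<bar>t - of_int m\<bar> \<and>
     (\<forall>k::int. \<bar>t - of_int m\<bar> \<le> \<bar>t - of_int k\<bar>)"
proof -
  define m where "m = round t"
  have le: "\<bar>t - of_int m\<bar> \<le> \<bar>t - of_int k\<bar>" for k :: int
    unfolding m_def by (rule round_diff_minimal)
  have "(INF k::int. \<bar>t - of_int k\<bar>) = \<bar>t - of_int m\<bar>"
    using le by (intro cInf_eq_minimum) auto
  then show ?thesis using le by (auto simp: circle_norm.abs_eq)
qed

text \<open>The sigma-algebra is the quotient one, which is the Borel sigma-algebra of the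
  quotient topology on \<open>\<real>/\<int>\<close>.\<close>

definition circle_space :: "circle measure" where
  "circle_space = sigma UNIV {A. abs_circle -` A \<in> sets borel}"

definition circle_uniform :: "circle measure" where
  "circle_uniform = distr (uniform_measure lborel {0..<1}) circle_space abs_circle"

text \<open>A point of the \<open>D\<close>-dimensional torus is a function on \<open>{1..D}\<close> (extensional, as in
  \<^const>\<open>PiM\<close>); the uniform measure is the product of the uniform measures.\<close>

definition torus_uniform :: "nat \<Rightarrow> (nat \<Rightarrow> circle) measure" where
  "torus_uniform D = PiM {1..D} (\<lambda>_. circle_uniform)"

definition torus_dist :: "nat \<Rightarrow> (nat \<Rightarrow> circle) \<Rightarrow> (nat \<Rightarrow> circle) \<Rightarrow> real" where
  "torus_dist D x y = (MAX i\<in>{1..D}. circle_norm (x i - y i))"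

lemma space_circle_space [simp]: "space circle_space = UNIV"
  by (simp add: circle_space_def space_measure_of_conv)

lemma sets_circle_space: "sets circle_space = {A. abs_circle -` A \<in> sets borel}"
proof -
  have "sigma_algebra UNIV {A. abs_circle -` A \<in> sets borel}"
  proof (rule sigma_algebra_iff2[THEN iffD2], intro conjI ballI allI impI)
    fix A :: "circle set"
    assume "A \<in> {A. abs_circle -` A \<in> sets borel}"
    then have "UNIV - abs_circle -` A \<in> sets borel"
      using sets.compl_sets[of "abs_circle -` A" borel] by simp
    then show "UNIV - A \<in> {A. abs_circle -` A \<in> sets borel}"
      by (simp add: vimage_Diff)
  next
    fix A :: "nat \<Rightarrow> circle set"
    assume "range A \<subseteq> {A. abs_circle -` A \<in> sets borel}"
    then have "(\<Union>i. abs_circle -` A i) \<in> sets borel"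
      by (intro sets.countable_UN) auto
    then show "(\<Union>i. A i) \<in> {A. abs_circle -` A \<in> sets borel}"
      by (simp add: vimage_UN)
  qed auto
  then show ?thesis
    by (simp add: circle_space_def sigma_algebra.sigma_sets_eq)
qed

lemma measurable_abs_circle [measurable]: "abs_circle \<in> borel \<rightarrow>\<^sub>M circle_space"
  by (rule measurableI) (auto simp: sets_circle_space)

lemma prob_space_circle_uniform: "prob_space circle_uniform"
proof -
  interpret U: prob_space "uniform_measure lborel {0..<1::real}"
    by (rule prob_space_uniform_measure) auto
  show ?thesis
    unfolding circle_uniform_def by (rule U.prob_space_distr) simp
qed

lemma prob_space_torus_uniform: "prob_space (torus_uniform D)"
  unfolding torus_uniform_def by (rule prob_space_PiM) (rule prob_space_circle_uniform)


section \<open>Graphs\<close>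

text \<open>A graph is a pair of a vertex set and a set of two-element edges.\<close>

type_synonym 'v graph = "'v set \<times> 'v set set"

definition simple_graph :: "'v graph \<Rightarrow> bool" where
  "simple_graph G \<longleftrightarrow> finite (fst G) \<and> (\<forall>e\<in>snd G. e \<subseteq> fst G \<and> card e = 2)"

definition geometric_graph :: "nat \<Rightarrow> nat \<Rightarrow> real \<Rightarrow> (nat \<Rightarrow> nat \<Rightarrow> circle) \<Rightarrow> nat graph" where
  "geometric_graph D n r x =
    ({1..n}, {{i, j} | i j. i \<in> {1..n} \<and> j \<in> {1..n} \<and> i \<noteq> j \<and> torus_dist D (x i) (x j) \<le> r})"

definition matching_graph :: "nat \<Rightarrow> nat \<Rightarrow> nat graph" where
  "matching_graph j N = ({..<2 * j + N}, {{2 * i, 2 * i + 1} | i. i < j})"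

lemma simple_graph_geometric_graph: "simple_graph (geometric_graph D n r x)" (is "simple_graph ?G")
proof -
  have "e \<subseteq> fst (?G) \<and> card e = 2" if e: "e \<in> snd (?G)" for e
  proof -
    obtain i j where "e = {i, j}" "i \<in> {1..n}" "j \<in> {1..n}" "i \<noteq> j" using e unfolding geometric_graph_def by auto
    then show ?thesis by (simp add: geometric_graph_def)
  qed
  moreover have "finite (fst (?G))" by (simp add: geometric_graph_def)
  ultimately show ?thesis unfolding simple_graph_def by blast
qed

lemma simple_graph_matching_graph: "simple_graph (matching_graph j N)" (is "simple_graph ?G")
proof -
  have "e \<subseteq> fst (?G) \<and> card e = 2" if e: "e \<in> snd (?G)" for e
  proof -
    obtain i where "e = {2 * i, 2 * i + 1}" "i < j" using e unfolding matching_graph_def by auto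
    then show ?thesis by (simp add: matching_graph_def)
  qed
  moreover have "finite (fst (?G))" by (simp add: matching_graph_def)
  ultimately show ?thesis unfolding simple_graph_def by blast
qed


section \<open>First-order logic of graphs\<close>

datatype formula =
    Eq nat nat
  | Adj nat nat
  | Neg formula
  | Conj formula formula
  | Ex nat formula

primrec free_vars :: "formula \<Rightarrow> nat set" where
  "free_vars (Eq x y) = {x, y}"
| "free_vars (Adj x y) = {x, y}"
| "free_vars (Neg \<phi>) = free_vars \<phi>"
| "free_vars (Conj \<phi> \<psi>) = free_vars \<phi> \<union> free_vars \<psi>"
| "free_vars (Ex x \<phi>) = free_vars \<phi> - {x}"

definition sentence :: "formula \<Rightarrow> bool" where
  "sentence \<phi> \<longleftrightarrow> free_vars \<phi> = {}"

primrec sat :: "'v graph \<Rightarrow> (nat \<Rightarrow> 'v) \<Rightarrow> formula \<Rightarrow> bool" where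
  "sat G \<sigma> (Eq x y) \<longleftrightarrow> \<sigma> x = \<sigma> y"
| "sat G \<sigma> (Adj x y) \<longleftrightarrow> {\<sigma> x, \<sigma> y} \<in> snd G"
| "sat G \<sigma> (Neg \<phi>) \<longleftrightarrow> \<not> sat G \<sigma> \<phi>"
| "sat G \<sigma> (Conj \<phi> \<psi>) \<longleftrightarrow> sat G \<sigma> \<phi> \<and> sat G \<sigma> \<psi>"
| "sat G \<sigma> (Ex x \<phi>) \<longleftrightarrow> (\<exists>v\<in>fst G. sat G (\<sigma>(x := v)) \<phi>)"

text \<open>The assignment is irrelevant for sentences. It is not required to map into the vertex
  set, so that sentences also get their usual truth values in the graph without vertices.\<close>

definition models :: "'v graph \<Rightarrow> formula \<Rightarrow> bool" (infix "\<Turnstile>" 50) where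
  "G \<Turnstile> \<phi> \<longleftrightarrow> (\<forall>\<sigma>. sat G \<sigma> \<phi>)"

lemma sat_cong_free_vars:
  "(\<And>x. x \<in> free_vars \<phi> \<Longrightarrow> \<sigma> x = \<tau> x) \<Longrightarrow> sat G \<sigma> \<phi> \<longleftrightarrow> sat G \<tau> \<phi>"
proof (induction \<phi> arbitrary: \<sigma> \<tau>)
  case (Ex x \<phi>)
  have "sat G (\<sigma>(x := v)) \<phi> \<longleftrightarrow> sat G (\<tau>(x := v)) \<phi>" for v
    by (rule Ex.IH) (use Ex.prems in auto)
  then show ?case by simp
next
  case (Conj \<phi> \<psi>)
  have "sat G \<sigma> \<phi> \<longleftrightarrow> sat G \<tau> \<phi>"
    by (rule Conj.IH(1)) (rule Conj.prems, simp)
  moreover have "sat G \<sigma> \<psi> \<longleftrightarrow> sat G \<tau> \<psi>"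
    by (rule Conj.IH(2)) (rule Conj.prems, simp)
  ultimately show ?case by simp
next
  case (Neg \<phi>)
  have "sat G \<sigma> \<phi> \<longleftrightarrow> sat G \<tau> \<phi>"
    by (rule Neg.IH) (rule Neg.prems, simp)
  then show ?case by simp
qed simp_all

lemma models_sentence:
  assumes "sentence \<phi>"
  shows "G \<Turnstile> \<phi> \<longleftrightarrow> sat G \<sigma> \<phi>"
proof -
  have eq: "sat G \<tau> \<phi> \<longleftrightarrow> sat G \<sigma> \<phi>" for \<tau>
    by (rule sat_cong_free_vars) (use assms in \<open>simp add: sentence_def\<close>)
  show ?thesis unfolding models_def using eq by blast
qed

text \<open>The number \<open>b\<^sub>\<phi>(j)\<close>.\<close>

definition eventual_truth :: "formula \<Rightarrow> nat \<Rightarrow> real" where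
  "eventual_truth \<phi> j = of_bool (\<forall>\<^sub>F N in sequentially. matching_graph j N \<Turnstile> \<phi>)"


section \<open>Sequences of random graphs\<close>

definition graph_prob :: "'w measure \<Rightarrow> ('w \<Rightarrow> 'v graph) \<Rightarrow> formula \<Rightarrow> real" where
  "graph_prob M G \<phi> = measure M {\<omega> \<in> space M. G \<omega> \<Turnstile> \<phi>}"

definition zero_one_law :: "(nat \<Rightarrow> 'w measure) \<Rightarrow> (nat \<Rightarrow> 'w \<Rightarrow> 'v graph) \<Rightarrow> bool" where
  "zero_one_law M G \<longleftrightarrow> (\<forall>\<phi>. sentence \<phi> \<longrightarrow>
     (\<lambda>n. graph_prob (M n) (G n) \<phi>) \<longlonglongrightarrow> 0 \<or> (\<lambda>n. graph_prob (M n) (G n) \<phi>) \<longlonglongrightarrow> 1)"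

end

theory Submission
  imports Defs
begin

text \<open>Each edge is present with probability \<open>p = (2r)\<^sup>D\<close>, independently of the graph on the
  vertices away from it, and any two edges are independent, even adjacent ones. With
  \<open>m = (n choose 2) p \<rightarrow> \<lambda>\<close> this gives, for the number \<open>W\<close> of edges, first
  that all edges are disjoint up to probability \<open>O(m n p) \<rightarrow> 0\<close>, and second, by summing
  \<open>P(e \<in> H, W = j + 1) \<approx> p P(W = j)\<close> over all edges \<open>e\<close>, the recurrence
  \<open>(j + 1) P(W = j + 1) - m P(W = j) \<rightarrow> 0\<close>. Together with the Markov bound
  \<open>P(W > J) \<le> m / (J + 1)\<close> the recurrence forces \<open>W\<close> to be Poisson in the limit.
  On the event that the edges are disjoint the graph is \<open>M(W, n - 2W)\<close>, whose first-order
  theory of bounded quantifier rank depends only on \<open>W\<close> once \<open>n - 2W\<close> is large.\<close>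

section \<open>Adding isolated vertices\<close>

primrec quantifier_rank :: "formula \<Rightarrow> nat" where
  "quantifier_rank (Eq x y) = 0"
| "quantifier_rank (Adj x y) = 0"
| "quantifier_rank (Neg \<phi>) = quantifier_rank \<phi>"
| "quantifier_rank (Conj \<phi> \<psi>) = max (quantifier_rank \<phi>) (quantifier_rank \<psi>)"
| "quantifier_rank (Ex x \<phi>) = Suc (quantifier_rank \<phi>)"

lemma finite_free_vars: "finite (free_vars \<phi>)"
  by (induction \<phi>) auto

text \<open>Values outside \<open>fst G\<close> never matter, since a quantifier assigns only
  vertices; surjectivity of \<open>f\<close> turns every witness in \<open>G'\<close> into the image
  of a witness in \<open>G\<close>. The version with free variables is needed for automorphisms that
  move the value of one variable.\<close>

lemma sat_iso:
  assumes f: "bij_betw f (fst G) (fst G')"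
    and adj: "\<And>u v. u \<in> fst G \<Longrightarrow> v \<in> fst G \<Longrightarrow> {f u, f v} \<in> snd G' \<longleftrightarrow> {u, v} \<in> snd G"
    and \<sigma>: "\<sigma> ` free_vars \<phi> \<subseteq> fst G"
  shows "sat G' (f \<circ> \<sigma>) \<phi> \<longleftrightarrow> sat G \<sigma> \<phi>"
  using \<sigma>
proof (induction \<phi> arbitrary: \<sigma>)
  case (Eq x y)
  then show ?case using f by (auto simp: bij_betw_def inj_on_def)
next
  case (Ex x \<phi>)
  have "sat G' ((f \<circ> \<sigma>)(x := f v)) \<phi> \<longleftrightarrow> sat G (\<sigma>(x := v)) \<phi>" if "v \<in> fst G" for v
  proof -
    have "sat G' (f \<circ> (\<sigma>(x := v))) \<phi> \<longleftrightarrow> sat G (\<sigma>(x := v)) \<phi>"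
      using Ex.prems that by (intro Ex.IH) auto
    then show ?thesis by (simp add: fun_upd_comp)
  qed
  moreover have "fst G' = f ` fst G" using f by (simp add: bij_betw_def)
  ultimately show ?case by (simp del: fun_upd_apply comp_apply fun.map_comp add: image_iff)
qed (auto simp: adj)

lemma models_iso:
  assumes "sentence \<phi>" "bij_betw f (fst G) (fst G')"
    and "\<And>u v. u \<in> fst G \<Longrightarrow> v \<in> fst G \<Longrightarrow> {f u, f v} \<in> snd G' \<longleftrightarrow> {u, v} \<in> snd G"
  shows "G' \<Turnstile> \<phi> \<longleftrightarrow> G \<Turnstile> \<phi>"
proof -
  have "sat G' (f \<circ> (\<lambda>_. undefined)) \<phi> \<longleftrightarrow> sat G (\<lambda>_. undefined) \<phi>"
    using assms by (intro sat_iso) (auto simp: sentence_def)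
  then show ?thesis by (simp only: models_sentence[OF assms(1), symmetric])
qed

text \<open>A witness among the additional isolated vertices can be exchanged with an isolated vertex
  of \<open>V\<close> that is not the value of a free variable; the exchange is an automorphism of the
  larger graph.\<close>

lemma sat_add_isolated:
  assumes "finite V" "V \<subseteq> V'" "\<Union>E \<subseteq> V" "\<sigma> ` free_vars \<phi> \<subseteq> V"
    and "quantifier_rank \<phi> + card (free_vars \<phi>) \<le> card (V - \<Union>E)"
  shows "sat (V', E) \<sigma> \<phi> \<longleftrightarrow> sat (V, E) \<sigma> \<phi>"
  using assms(4,5)
proof (induction \<phi> arbitrary: \<sigma>)
  case (Conj \<phi> \<psi>)
  have "card (free_vars \<phi>) \<le> card (free_vars (Conj \<phi> \<psi>))"
       "card (free_vars \<psi>) \<le> card (free_vars (Conj \<phi> \<psi>))"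
    by (auto intro!: card_mono simp: finite_free_vars)
  then have "sat (V', E) \<sigma> \<phi> \<longleftrightarrow> sat (V, E) \<sigma> \<phi>" "sat (V', E) \<sigma> \<psi> \<longleftrightarrow> sat (V, E) \<sigma> \<psi>"
    using Conj.prems by (auto intro!: Conj.IH)
  then show ?case by simp
next
  case (Ex x \<phi>)
  \<comment> \<open>Passing under the quantifier lowers the rank by one and adds at most one free
    variable, so the sum bounded in the hypothesis does not grow.\<close>
  have "card (free_vars \<phi>) \<le> Suc (card (free_vars (Ex x \<phi>)))"
    using card_Suc_Diff1[of "free_vars \<phi>" x] finite_free_vars[of \<phi>]
    by (cases "x \<in> free_vars \<phi>") auto
  then have IH: "sat (V', E) (\<sigma>(x := v)) \<phi> \<longleftrightarrow> sat (V, E) (\<sigma>(x := v)) \<phi>" if "v \<in> V" for v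
    using Ex.prems that by (intro Ex.IH) auto
  have "\<exists>w\<in>V. sat (V', E) (\<sigma>(x := w)) \<phi>" if v: "v \<in> V'" "v \<notin> V" "sat (V', E) (\<sigma>(x := v)) \<phi>" for v
  proof -
    define S where "S = \<sigma> ` free_vars (Ex x \<phi>)"
    have "finite S" "card S \<le> card (free_vars (Ex x \<phi>))"
      unfolding S_def using finite_free_vars[of "Ex x \<phi>"] by (auto intro: card_image_le simp del: free_vars.simps)
    \<comment> \<open>The rank of \<open>Ex x \<phi>\<close> is at least one, so the inequality is
      strict and leaves room for \<open>w\<close>.\<close>
    then have "card S < card (V - \<Union>E)" using Ex.prems(2) by simp
    then obtain w where w: "w \<in> V - \<Union>E" "w \<notin> S"
      by (metis \<open>finite S\<close> card_mono not_le subsetI)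
    define f where "f = Transposition.transpose v w"
    have fix_E: "f u = u" if "u \<in> \<Union>E" for u
      using that w v assms(3) by (auto simp: f_def Transposition.transpose_def)
    have inj: "inj f" and inv: "f (f u) = u" for u by (auto simp: f_def)
    have "sat (V', E) (f \<circ> (\<sigma>(x := v))) \<phi> \<longleftrightarrow> sat (V', E) (\<sigma>(x := v)) \<phi>"
    proof (rule sat_iso)
      have "f ` V' = V'" using v w assms(2) by (auto simp: f_def intro!: transpose_image_eq)
      then show "bij_betw f (fst (V', E)) (fst (V', E))"
        using inj by (auto simp: bij_betw_def inj_on_def)
      show "{f s, f t} \<in> snd (V', E) \<longleftrightarrow> {s, t} \<in> snd (V', E)" for s t
      proof
        assume "{f s, f t} \<in> snd (V', E)"
        then have "f (f s) = f s" "f (f t) = f t" by (auto intro!: fix_E)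
        then have "f s = s" "f t = t" by (simp_all only: inv)
        with \<open>{f s, f t} \<in> snd (V', E)\<close> show "{s, t} \<in> snd (V', E)" by simp
      next
        assume "{s, t} \<in> snd (V', E)"
        then have "f s = s" "f t = t" by (auto intro!: fix_E)
        with \<open>{s, t} \<in> snd (V', E)\<close> show "{f s, f t} \<in> snd (V', E)" by simp
      qed
      show "(\<sigma>(x := v)) ` free_vars \<phi> \<subseteq> fst (V', E)"
        using Ex.prems(1) assms(2) v by auto
    qed
    \<comment> \<open>The other free variables take values in \<open>V\<close>, hence not
      \<open>v\<close>, and in \<open>S\<close>, hence not \<open>w\<close>; the transposition
      changes only the value of \<open>x\<close>.\<close>
    moreover have "sat (V', E) (f \<circ> (\<sigma>(x := v))) \<phi> \<longleftrightarrow> sat (V', E) (\<sigma>(x := w)) \<phi>"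
    proof (rule sat_cong_free_vars)
      fix y assume y: "y \<in> free_vars \<phi>"
      have "\<sigma> y \<in> S" "\<sigma> y \<in> V" if "y \<noteq> x" using y that Ex.prems(1) by (auto simp: S_def)
      then have "f (\<sigma> y) = \<sigma> y" if "y \<noteq> x"
        using that v(2) w(2) unfolding f_def by (metis transpose_apply_other)
      then show "(f \<circ> (\<sigma>(x := v))) y = (\<sigma>(x := w)) y" by (simp add: f_def)
    qed
    ultimately show ?thesis using v w by blast
  qed
  then show ?case using IH assms(2) by auto
qed auto

section \<open>Matching graphs and their eventual truth values\<close>

lemma isolated_matching_graph:
  "{..<2 * j + N} - \<Union>(snd (matching_graph j N)) = {2 * j..<2 * j + N}"
proof -
  have "\<Union>(snd (matching_graph j N)) = {..<2 * j}"
  proof (intro equalityI subsetI)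
    fix k assume "k \<in> {..<2 * j}"
    then have "k div 2 < j" "k \<in> {2 * (k div 2), 2 * (k div 2) + 1}" by auto
    then show "k \<in> \<Union>(snd (matching_graph j N))"
      unfolding matching_graph_def snd_conv by blast
  qed (auto simp: matching_graph_def)
  then show ?thesis by auto
qed

text \<open>The two graphs share their edges and differ only in isolated vertices; a sentence has no
  free variables, so \<open>sat_add_isolated\<close> asks only for as many isolated vertices as the
  rank.\<close>

lemma models_matching_graph_mono:
  assumes "sentence \<phi>" "quantifier_rank \<phi> \<le> N" "N \<le> N'"
  shows "matching_graph j N' \<Turnstile> \<phi> \<longleftrightarrow> matching_graph j N \<Turnstile> \<phi>"
proof -
  define E :: "nat set set" where "E = {{2 * i, 2 * i + 1} | i. i < j}"
  have G: "matching_graph j K = ({..<2 * j + K}, E)" for K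
    by (simp add: matching_graph_def E_def)
  have "{..<2 * j + N} - \<Union>E = {2 * j..<2 * j + N}"
    using isolated_matching_graph[of j N] by (simp add: G)
  then have "sat ({..<2 * j + N'}, E) \<sigma> \<phi> \<longleftrightarrow> sat ({..<2 * j + N}, E) \<sigma> \<phi>" for \<sigma>
    using assms by (intro sat_add_isolated) (auto simp: E_def sentence_def)
  then show ?thesis by (simp add: G models_def)
qed

text \<open>The threshold depends on the rank alone and not on \<open>j\<close>, so one lower bound
  on the number of isolated vertices serves all edge counts at once.\<close>

lemma eventual_truth_eq:
  assumes "sentence \<phi>" "quantifier_rank \<phi> \<le> N"
  shows "eventual_truth \<phi> j = of_bool (matching_graph j N \<Turnstile> \<phi>)"
proof -
  have "(\<forall>\<^sub>F K in sequentially. matching_graph j K \<Turnstile> \<phi>) \<longleftrightarrow> (\<forall>\<^sub>F K in sequentially. matching_graph j N \<Turnstile> \<phi>)"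
    by (intro eventually_cong[OF eventually_ge_at_top[of N]] models_matching_graph_mono assms refl)
  then show ?thesis by (simp add: eventual_truth_def)
qed

text \<open>By this dichotomy the value 0 of \<open>eventual_truth\<close> means eventual falsity,
  not mere failure to be eventually true.\<close>

lemma eventually_matching_graph_const:
  assumes "sentence \<phi>"
  shows "(\<forall>\<^sub>F N in sequentially. matching_graph j N \<Turnstile> \<phi>) \<or>
         (\<forall>\<^sub>F N in sequentially. \<not> matching_graph j N \<Turnstile> \<phi>)"
proof -
  have "\<forall>\<^sub>F N in sequentially. matching_graph j N \<Turnstile> \<phi> \<longleftrightarrow> matching_graph j (quantifier_rank \<phi>) \<Turnstile> \<phi>"
    using eventually_ge_at_top[of "quantifier_rank \<phi>"]
    by eventually_elim (rule models_matching_graph_mono[OF assms order.refl])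
  then show ?thesis
    by (cases "matching_graph j (quantifier_rank \<phi>) \<Turnstile> \<phi>") simp_all
qed

lemma matching_enumeration:
  assumes "finite E" "\<forall>e\<in>E. card e = 2" "pairwise disjnt E"
  shows "\<exists>f. inj_on f (\<Union>E) \<and> (`) f ` E = {{2 * i, 2 * i + 1} | i. i < card E} \<and>
             f ` \<Union>E = {..<2 * card E}"
  using assms
proof (induction E)
  case (insert e E)
  then obtain f where f: "inj_on f (\<Union>E)" "(`) f ` E = {{2 * i, 2 * i + 1} | i. i < card E}"
    "f ` \<Union>E = {..<2 * card E}" by (auto simp: pairwise_insert)
  obtain u v where e: "e = {u, v}" "u \<noteq> v" using insert.prems(1) by (auto simp: card_2_iff)
  have disj: "u \<notin> \<Union>E" "v \<notin> \<Union>E"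
    using insert.prems(2) insert.hyps(2) e by (auto simp: pairwise_insert disjnt_def)
  define g where "g = f(u := 2 * card E, v := 2 * card E + 1)"
  have g_f: "g w = f w" if "w \<in> \<Union>E" for w using that disj by (auto simp: g_def)
  have g_e: "g u = 2 * card E" "g v = 2 * card E + 1" using e by (auto simp: g_def)
  have im: "g ` \<Union>E = {..<2 * card E}" using f(3) g_f by (metis image_cong)
  have "inj_on g (\<Union>E)" using f(1) g_f by (metis inj_on_cong)
  then have "inj_on g (\<Union>(insert e E))"
    using im g_e disj by (auto simp: e(1) inj_on_insert)
  moreover have "(`) g ` insert e E = {{2 * i, 2 * i + 1} | i. i < card (insert e E)}"
  proof -
    have "(`) g ` E = (`) f ` E" using g_f by (intro image_cong refl) auto
    then show ?thesis
      using insert.hyps f(2) g_e by (auto simp: e(1) less_Suc_eq)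
  qed
  moreover have "g ` \<Union>(insert e E) = {..<2 * card (insert e E)}"
    using im g_e insert.hyps by (auto simp: e(1) image_Un)
  ultimately show ?case by blast
qed simp

text \<open>The numbering of the covered vertices is extended by any bijection from the uncovered
  vertices onto the remaining numbers, which gives an isomorphism with a matching graph. The first
  claim ensures that the natural-number subtraction in the second is not truncated.\<close>

lemma models_matching:
  assumes "sentence \<phi>" "finite V" "E \<subseteq> Pow V" "\<forall>e\<in>E. card e = 2" "pairwise disjnt E"
  shows "2 * card E \<le> card V"
    and "(V, E) \<Turnstile> \<phi> \<longleftrightarrow> matching_graph (card E) (card V - 2 * card E) \<Turnstile> \<phi>"
proof -
  have sub: "\<Union>E \<subseteq> V" using assms(3) by blast
  have fin: "finite E" "finite (\<Union>E)"
    using finite_subset[OF assms(3)] finite_subset[OF sub] assms(2) by simp_all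
  obtain f where f: "inj_on f (\<Union>E)" "(`) f ` E = {{2 * i, 2 * i + 1} | i. i < card E}"
    "f ` \<Union>E = {..<2 * card E}" using matching_enumeration[OF fin(1) assms(4,5)]
    by (elim exE conjE) (rule that)
  have card_U: "card (\<Union>E) = 2 * card E"
    using card_image[OF f(1)] f(3) by simp
  then show le: "2 * card E \<le> card V" using card_mono[OF assms(2) sub] by simp
  have "card (V - \<Union>E) = card {2 * card E..<card V}"
    using card_Diff_subset[OF fin(2) sub] card_U by simp
  then obtain g where g: "bij_betw g (V - \<Union>E) {2 * card E..<card V}"
    using finite_same_card_bij[of "V - \<Union>E" "{2 * card E..<card V}"] assms(2) by auto
  define h where "h u = (if u \<in> \<Union>E then f u else g u)" for u
  have "bij_betw h (\<Union>E \<union> (V - \<Union>E)) ({..<2 * card E} \<union> {2 * card E..<card V})"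
  proof (rule bij_betw_combine)
    have "bij_betw f (\<Union>E) {..<2 * card E}" using f by (simp add: bij_betw_def)
    then show "bij_betw h (\<Union>E) {..<2 * card E}" by (rule bij_betw_cong[THEN iffD1, rotated]) (simp add: h_def)
    show "bij_betw h (V - \<Union>E) {2 * card E..<card V}" using g
      by (rule bij_betw_cong[THEN iffD1, rotated]) (auto simp: h_def)
  qed auto
  moreover have "\<Union>E \<union> (V - \<Union>E) = V" "{..<2 * card E} \<union> {2 * card E..<card V} = {..<card V}"
    using sub le by auto
  ultimately have bij: "bij_betw h V {..<card V}" by simp
  have imE: "(`) h ` E = {{2 * i, 2 * i + 1} | i. i < card E}"
  proof -
    have "(`) h ` E = (`) f ` E" by (intro image_cong refl) (auto simp: h_def)
    then show ?thesis using f(2) by simp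
  qed
  have "matching_graph (card E) (card V - 2 * card E) \<Turnstile> \<phi> \<longleftrightarrow> (V, E) \<Turnstile> \<phi>"
  proof (rule models_iso[OF assms(1)])
    show "bij_betw h (fst (V, E)) (fst (matching_graph (card E) (card V - 2 * card E)))"
      using bij le by (simp add: matching_graph_def)
    fix u v assume uv: "u \<in> fst (V, E)" "v \<in> fst (V, E)"
    have inj: "inj_on h V" using bij by (simp add: bij_betw_def)
    have "{h u, h v} \<in> (`) h ` E \<longleftrightarrow> {u, v} \<in> E"
    proof
      assume "{h u, h v} \<in> (`) h ` E"
      then obtain e where "e \<in> E" "h ` {u, v} = h ` e" by auto
      moreover have "e \<subseteq> V" "{u, v} \<subseteq> V" using \<open>e \<in> E\<close> assms(3) uv by auto
      ultimately show "{u, v} \<in> E" using inj_on_image_eq_iff[OF inj] by metis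
    qed (auto intro: image_eqI[where x = "{u, v}"])
    then show "{h u, h v} \<in> snd (matching_graph (card E) (card V - 2 * card E)) \<longleftrightarrow> {u, v} \<in> snd (V, E)"
      by (simp add: imE matching_graph_def)
  qed
  then show "(V, E) \<Turnstile> \<phi> \<longleftrightarrow> matching_graph (card E) (card V - 2 * card E) \<Turnstile> \<phi>" by simp
qed

section \<open>Random edge sets\<close>

text \<open>Only finitely many values \<open>S\<close> are possible, so the event is a finite union
  of events \<open>F x = S\<close>, each decided by finitely many memberships. This allows an
  arbitrary predicate \<open>Q\<close>.\<close>

lemma sets_Collect_finite_set_valued:
  assumes "finite K" "\<And>x. F x \<subseteq> K" "\<And>e. e \<in> K \<Longrightarrow> {x \<in> space N. e \<in> F x} \<in> sets N"
  shows "{x \<in> space N. Q (F x)} \<in> sets N"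
proof -
  have mem_iff: "{x \<in> space N. e \<in> F x \<longleftrightarrow> e \<in> S} \<in> sets N" if "e \<in> K" for e S
    using assms(3)[OF that] by (cases "e \<in> S") (auto intro: sets.sets_Collect_neg)
  have "{x \<in> space N. \<forall>e\<in>K. e \<in> F x \<longleftrightarrow> e \<in> S} \<in> sets N" for S
    by (rule sets.sets_Collect_finite_All[OF mem_iff assms(1)])
  moreover have "F x = S \<longleftrightarrow> (\<forall>e\<in>K. e \<in> F x \<longleftrightarrow> e \<in> S)" if "S \<subseteq> K" for S x
    using assms(2)[of x] that by blast
  ultimately have "{x \<in> space N. F x = S} \<in> sets N" if "S \<subseteq> K" for S
    using that by simp
  then have "(\<Union>S\<in>{S \<in> Pow K. Q S}. {x \<in> space N. F x = S}) \<in> sets N"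
    by (intro sets.finite_UN) (auto simp: assms(1))
  also have "(\<Union>S\<in>{S \<in> Pow K. Q S}. {x \<in> space N. F x = S}) = {x \<in> space N. Q (F x)}"
    using assms(2) by auto
  finally show ?thesis .
qed

text \<open>All that the counting argument uses of the geometry. In \<open>edge_indep\<close> only
  edges at \<open>v\<close> are kept out of the conditioning; edges at \<open>u\<close> may occur
  there. Joint independence of all edges would be too much to ask, since the edges of a triangle are
  in general dependent.\<close>

locale random_edge_set = prob_space M for M :: "'w measure" +
  fixes V :: "'v set" and H :: "'w \<Rightarrow> 'v set set" and p :: real
  assumes finite_V: "finite V"
    and p_nonneg: "0 \<le> p"
    and H_subset: "H \<omega> \<subseteq> {e. e \<subseteq> V \<and> card e = 2}"
    and edge_event: "u \<in> V \<Longrightarrow> v \<in> V \<Longrightarrow> {\<omega> \<in> space M. {u, v} \<in> H \<omega>} \<in> events"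
    and edge_indep: "u \<in> V \<Longrightarrow> v \<in> V \<Longrightarrow> u \<noteq> v \<Longrightarrow>
      prob {\<omega> \<in> space M. {u, v} \<in> H \<omega> \<and> Q {e \<in> H \<omega>. v \<notin> e}} =
      p * prob {\<omega> \<in> space M. Q {e \<in> H \<omega>. v \<notin> e}}"
begin

definition all_edges :: "'v set set" where
  "all_edges = {e. e \<subseteq> V \<and> card e = 2}"

abbreviation pr :: "('v set set \<Rightarrow> bool) \<Rightarrow> real" where
  "pr Q \<equiv> prob {\<omega> \<in> space M. Q (H \<omega>)}"

lemma finite_all_edges: "finite all_edges"
  unfolding all_edges_def using finite_V by simp

lemma card_all_edges: "card all_edges = card V choose 2"
  unfolding all_edges_def by (rule n_subsets[OF finite_V])

lemma all_edgesE:
  assumes "e \<in> all_edges" "v \<in> e"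
  obtains u where "e = {u, v}" "u \<in> V" "v \<in> V" "u \<noteq> v"
proof -
  have "card e = 2" "e \<subseteq> V" using assms by (auto simp: all_edges_def)
  then obtain a b where "e = {a, b}" "a \<noteq> b" by (auto simp: card_2_iff)
  then show ?thesis using that[of a] that[of b] assms(2) \<open>e \<subseteq> V\<close> by blast
qed

section \<open>Events of the finite edge set and union bounds\<close>

lemma H_Pow: "H \<omega> \<in> Pow all_edges"
  using H_subset[of \<omega>] by (simp add: all_edges_def)

lemma event: "{\<omega> \<in> space M. Q (H \<omega>)} \<in> events"
proof (rule sets_Collect_finite_set_valued[OF finite_all_edges])
  show "H \<omega> \<subseteq> all_edges" for \<omega> using H_Pow by blast
  fix e assume e: "e \<in> all_edges"
  then have "e \<noteq> {}" by (auto simp: all_edges_def)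
  then obtain u v where "e = {u, v}" "u \<in> V" "v \<in> V" using all_edgesE[OF e] by blast
  then show "{\<omega> \<in> space M. e \<in> H \<omega>} \<in> events" by (simp add: edge_event)
qed

text \<open>Writing probabilities against the finite law of \<open>H\<close> turns expectations of
  the edge count into finite sums that can be interchanged.\<close>

lemma pr_eq_sum: "pr Q = (\<Sum>S\<in>Pow all_edges. of_bool (Q S) * pr (\<lambda>T. T = S))"
proof -
  have "pr Q = prob (\<Union>S\<in>{S \<in> Pow all_edges. Q S}. {\<omega> \<in> space M. H \<omega> = S})"
    using H_Pow by (intro arg_cong[where f = prob]) auto
  also have "\<dots> = (\<Sum>S\<in>{S \<in> Pow all_edges. Q S}. pr (\<lambda>T. T = S))"
    using event by (intro finite_measure_finite_Union) (auto simp: finite_all_edges disjoint_family_on_def)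
  also have "\<dots> = (\<Sum>S\<in>Pow all_edges. of_bool (Q S) * pr (\<lambda>T. T = S))"
    by (intro sum.mono_neutral_cong_left) (auto simp: finite_all_edges)
  finally show ?thesis .
qed

lemma pr_le_add:
  assumes "\<And>S. S \<subseteq> all_edges \<Longrightarrow> Q S \<Longrightarrow> R S \<or> B S"
  shows "pr Q \<le> pr R + pr B"
proof -
  have "pr Q \<le> prob ({\<omega> \<in> space M. R (H \<omega>)} \<union> {\<omega> \<in> space M. B (H \<omega>)})"
    using assms H_Pow by (intro finite_measure_mono sets.Un event) auto
  also have "\<dots> \<le> pr R + pr B" by (intro measure_Un_le event)
  finally show ?thesis .
qed

lemma abs_pr_diff_le:
  assumes "\<And>S. S \<subseteq> all_edges \<Longrightarrow> Q S \<noteq> R S \<Longrightarrow> B S"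
  shows "\<bar>pr Q - pr R\<bar> \<le> pr B"
proof -
  have "pr Q \<le> pr R + pr B" by (rule pr_le_add) (use assms in blast)
  moreover have "pr R \<le> pr Q + pr B" by (rule pr_le_add) (use assms in blast)
  ultimately show ?thesis by linarith
qed

lemma pr_Bex_le:
  assumes "finite I" "\<And>i. i \<in> I \<Longrightarrow> pr (Q i) \<le> c"
  shows "pr (\<lambda>S. \<exists>i\<in>I. Q i S) \<le> real (card I) * c"
proof -
  have "pr (\<lambda>S. \<exists>i\<in>I. Q i S) = prob (\<Union>i\<in>I. {\<omega> \<in> space M. Q i (H \<omega>)})"
    by (intro arg_cong[where f = prob]) auto
  also have "\<dots> \<le> (\<Sum>i\<in>I. pr (Q i))"
    using event by (intro finite_measure_subadditive_finite assms) auto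
  also have "\<dots> \<le> real (card I) * c"
    using sum_bounded_above[of I "\<lambda>i. pr (Q i)" c] assms(2) by simp
  finally show ?thesis .
qed

text \<open>Edges disjoint from \<open>e\<close> are among those avoiding a single endpoint
  \<open>v\<close>, so \<open>edge_indep\<close> applies to a predicate that filters once
  more.\<close>

lemma pr_edge_avoiding:
  assumes e: "e \<in> all_edges"
  shows "pr (\<lambda>S. e \<in> S \<and> Q {f \<in> S. f \<inter> e = {}}) = p * pr (\<lambda>S. Q {f \<in> S. f \<inter> e = {}})"
proof -
  have "e \<noteq> {}" using e by (auto simp: all_edges_def)
  then obtain u v where uv: "e = {u, v}" "u \<in> V" "v \<in> V" "u \<noteq> v" using all_edgesE[OF e] by blast
  have "{f \<in> {f \<in> S. v \<notin> f}. f \<inter> e = {}} = {f \<in> S. f \<inter> e = {}}" for S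
    using uv(1) by auto
  then show ?thesis
    using edge_indep[OF uv(2-4), of "\<lambda>S. Q {f \<in> S. f \<inter> e = {}}"] uv(1) by simp
qed

lemma pr_edge: "e \<in> all_edges \<Longrightarrow> pr (\<lambda>S. e \<in> S) = p"
  using pr_edge_avoiding[of e "\<lambda>_. True"] by (simp add: prob_space)

text \<open>Distinct edges have equal size, so \<open>e\<close> has an endpoint \<open>v\<close>
  outside \<open>f\<close>. Then \<open>f\<close> is among the edges avoiding \<open>v\<close>, even
  if it shares the other endpoint of \<open>e\<close>.\<close>

lemma pr_two_edges:
  assumes e: "e \<in> all_edges" and f: "f \<in> all_edges" and "e \<noteq> f"
  shows "pr (\<lambda>S. e \<in> S \<and> f \<in> S) = p\<^sup>2"
proof -
  have "finite e" "finite f" "card e = card f"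
    using e f by (auto simp: all_edges_def intro: finite_subset[OF _ finite_V])
  then obtain v where v: "v \<in> e" "v \<notin> f" using card_subset_eq[of f e] \<open>e \<noteq> f\<close> by blast
  obtain u where uv: "e = {u, v}" "u \<in> V" "v \<in> V" "u \<noteq> v" using all_edgesE[OF e v(1)] .
  have "pr (\<lambda>S. e \<in> S \<and> f \<in> S) = p * pr (\<lambda>S. f \<in> S)"
    using edge_indep[OF uv(2-4), of "\<lambda>S. f \<in> S"] uv(1) v(2) by simp
  then show ?thesis using pr_edge[OF f] by (simp add: power2_eq_square)
qed

lemma card_meeting_edges:
  assumes e: "e \<in> all_edges"
  shows "card {f \<in> all_edges. f \<inter> e \<noteq> {}} \<le> 2 * card V"
proof -
  have e': "finite e" "card e = 2" using e by (auto simp: all_edges_def intro: finite_subset[OF _ finite_V])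
  have "{f \<in> all_edges. f \<inter> e \<noteq> {}} \<subseteq> (\<lambda>(x, y). {y, x}) ` (e \<times> V)"
  proof
    fix f assume "f \<in> {f \<in> all_edges. f \<inter> e \<noteq> {}}"
    then obtain x where "f \<in> all_edges" "x \<in> f" "x \<in> e" by blast
    then obtain y where "f = {y, x}" "y \<in> V" using all_edgesE by metis
    then show "f \<in> (\<lambda>(x, y). {y, x}) ` (e \<times> V)" using \<open>x \<in> e\<close> by (intro image_eqI[of _ _ "(x, y)"]) auto
  qed
  then have "card {f \<in> all_edges. f \<inter> e \<noteq> {}} \<le> card (e \<times> V)"
    using e' finite_V by (intro surj_card_le) auto
  then show ?thesis using e' by (simp add: card_cartesian_product)
qed

text \<open>Both parts are union bounds over the at most \<open>2 * card V\<close> edges meeting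
  \<open>e\<close>. The first leaves out \<open>e\<close> itself and pays \<open>p\<^sup>2\<close>
  per edge; the second includes \<open>e\<close> and pays \<open>p\<close>.\<close>

lemma pr_meeting_le:
  assumes e: "e \<in> all_edges"
  shows "pr (\<lambda>S. e \<in> S \<and> (\<exists>f\<in>S. f \<noteq> e \<and> f \<inter> e \<noteq> {})) \<le> 2 * card V * p\<^sup>2"
    and "pr (\<lambda>S. \<exists>f\<in>S. f \<inter> e \<noteq> {}) \<le> 2 * card V * p"
proof -
  define F where "F = {f \<in> all_edges. f \<inter> e \<noteq> {}}"
  have F: "finite F" "finite (F - {e})" by (simp_all add: F_def finite_all_edges)
  have card_F: "real (card F) \<le> 2 * card V"
    using card_meeting_edges[OF e] unfolding F_def by linarith
  have card_F': "real (card (F - {e})) \<le> 2 * card V"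
    using card_F card_Diff1_le[of F e] by linarith
  have "pr (\<lambda>S. e \<in> S \<and> (\<exists>f\<in>S. f \<noteq> e \<and> f \<inter> e \<noteq> {})) = pr (\<lambda>S. \<exists>f\<in>F - {e}. e \<in> S \<and> f \<in> S)"
    using H_Pow by (intro arg_cong[where f = prob]) (auto simp: F_def)
  also have "\<dots> \<le> real (card (F - {e})) * p\<^sup>2"
    by (intro pr_Bex_le F eq_refl pr_two_edges e) (auto simp: F_def)
  also have "\<dots> \<le> 2 * card V * p\<^sup>2" using card_F' by (intro mult_right_mono) auto
  finally show "pr (\<lambda>S. e \<in> S \<and> (\<exists>f\<in>S. f \<noteq> e \<and> f \<inter> e \<noteq> {})) \<le> 2 * card V * p\<^sup>2" .
  have "pr (\<lambda>S. \<exists>f\<in>S. f \<inter> e \<noteq> {}) = pr (\<lambda>S. \<exists>f\<in>F. f \<in> S)"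
    using H_Pow by (intro arg_cong[where f = prob]) (auto simp: F_def)
  also have "\<dots> \<le> real (card F) * p"
    by (intro pr_Bex_le F eq_refl pr_edge) (auto simp: F_def)
  also have "\<dots> \<le> 2 * card V * p" using card_F p_nonneg by (intro mult_right_mono) auto
  finally show "pr (\<lambda>S. \<exists>f\<in>S. f \<inter> e \<noteq> {}) \<le> 2 * card V * p" .
qed

lemma pr_not_matching_le:
  "pr (\<lambda>S. \<not> pairwise disjnt S) \<le> card all_edges * (2 * card V * p\<^sup>2)"
proof -
  have "pr (\<lambda>S. \<not> pairwise disjnt S) = pr (\<lambda>S. \<exists>e\<in>all_edges. e \<in> S \<and> (\<exists>f\<in>S. f \<noteq> e \<and> f \<inter> e \<noteq> {}))"
    using H_Pow by (intro arg_cong[where f = prob]) (auto simp: pairwise_def disjnt_def)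
  also have "\<dots> \<le> card all_edges * (2 * card V * p\<^sup>2)"
    by (intro pr_Bex_le finite_all_edges pr_meeting_le)
  finally show ?thesis .
qed

text \<open>If no other edge meets \<open>e\<close>, removing \<open>e\<close> leaves exactly the
  edges disjoint from it, and their number is independent of \<open>e\<close>. Afterwards this
  number is replaced by \<open>card S\<close> again; each of the two replacements costs
  \<open>2 * card V * p\<^sup>2\<close>.\<close>

lemma pr_edge_card:
  assumes e: "e \<in> all_edges"
  shows "\<bar>pr (\<lambda>S. e \<in> S \<and> card S = Suc j) - p * pr (\<lambda>S. card S = j)\<bar> \<le> 4 * card V * p\<^sup>2"
proof -
  have "\<bar>pr (\<lambda>S. e \<in> S \<and> card S = Suc j) - pr (\<lambda>S. e \<in> S \<and> card {f \<in> S. f \<inter> e = {}} = j)\<bar>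
      \<le> pr (\<lambda>S. e \<in> S \<and> (\<exists>f\<in>S. f \<noteq> e \<and> f \<inter> e \<noteq> {}))"
  proof (rule abs_pr_diff_le, rule ccontr)
    fix S assume S: "S \<subseteq> all_edges"
      and "(e \<in> S \<and> card S = Suc j) \<noteq> (e \<in> S \<and> card {f \<in> S. f \<inter> e = {}} = j)"
      and no: "\<not> (e \<in> S \<and> (\<exists>f\<in>S. f \<noteq> e \<and> f \<inter> e \<noteq> {}))"
    then have eS: "e \<in> S" and card: "card S \<noteq> Suc (card {f \<in> S. f \<inter> e = {}})" by auto
    have "e \<noteq> {}" using e by (auto simp: all_edges_def)
    have "S = insert e {f \<in> S. f \<inter> e = {}}" using eS no by blast
    moreover have "finite {f \<in> S. f \<inter> e = {}}" using finite_subset[OF S finite_all_edges] by simp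
    ultimately have "card S = Suc (card {f \<in> S. f \<inter> e = {}})"
      using \<open>e \<noteq> {}\<close> card_insert_disjoint[of "{f \<in> S. f \<inter> e = {}}" e] by force
    then show False using card by simp
  qed
  also have "\<dots> \<le> 2 * card V * p\<^sup>2" by (rule pr_meeting_le[OF e])
  finally have "\<bar>pr (\<lambda>S. e \<in> S \<and> card S = Suc j) - p * pr (\<lambda>S. card {f \<in> S. f \<inter> e = {}} = j)\<bar>
      \<le> 2 * card V * p\<^sup>2"
    using pr_edge_avoiding[OF e, of "\<lambda>S. card S = j"] by simp
  \<comment> \<open>Here the bad event has probability only of order \<open>card V * p\<close>; the
    missing power of \<open>p\<close> is the factor already split off.\<close>
  moreover have "\<bar>p * pr (\<lambda>S. card {f \<in> S. f \<inter> e = {}} = j) - p * pr (\<lambda>S. card S = j)\<bar> \<le> 2 * card V * p\<^sup>2"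
  proof -
    have "\<bar>pr (\<lambda>S. card {f \<in> S. f \<inter> e = {}} = j) - pr (\<lambda>S. card S = j)\<bar> \<le> pr (\<lambda>S. \<exists>f\<in>S. f \<inter> e \<noteq> {})"
    proof (rule abs_pr_diff_le, rule ccontr)
      fix S assume "(card {f \<in> S. f \<inter> e = {}} = j) \<noteq> (card S = j)" "\<not> (\<exists>f\<in>S. f \<inter> e \<noteq> {})"
      moreover from this(2) have "{f \<in> S. f \<inter> e = {}} = S" by blast
      ultimately show False by simp
    qed
    also have "\<dots> \<le> 2 * card V * p" by (rule pr_meeting_le[OF e])
    finally have "p * \<bar>pr (\<lambda>S. card {f \<in> S. f \<inter> e = {}} = j) - pr (\<lambda>S. card S = j)\<bar> \<le> p * (2 * card V * p)"
      using p_nonneg by (rule mult_left_mono)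
    moreover have eq: "\<bar>p * x - p * y\<bar> = p * \<bar>x - y\<bar>" for x y :: real
      using p_nonneg by (simp add: abs_mult flip: right_diff_distrib)
    ultimately show ?thesis unfolding eq by (simp add: power2_eq_square mult_ac)
  qed
  ultimately show ?thesis by linarith
qed

text \<open>Double counting: both sides are the expectation of the number of edges restricted to the
  event \<open>Q\<close>.\<close>

lemma sum_pr_edge:
  "(\<Sum>e\<in>all_edges. pr (\<lambda>S. e \<in> S \<and> Q S)) =
   (\<Sum>S\<in>Pow all_edges. real (card S) * of_bool (Q S) * pr (\<lambda>T. T = S))"
proof -
  have "(\<Sum>e\<in>all_edges. pr (\<lambda>S. e \<in> S \<and> Q S)) =
      (\<Sum>S\<in>Pow all_edges. \<Sum>e\<in>all_edges. of_bool (e \<in> S \<and> Q S) * pr (\<lambda>T. T = S))"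
    by (subst pr_eq_sum) (rule sum.swap)
  also have "\<dots> = (\<Sum>S\<in>Pow all_edges. real (card S) * of_bool (Q S) * pr (\<lambda>T. T = S))"
  proof (intro sum.cong refl)
    fix S assume "S \<in> Pow all_edges"
    then have "all_edges \<inter> S = S" by blast
    then have "(\<Sum>e\<in>all_edges. of_bool (e \<in> S)) = real (card S)"
      using finite_all_edges by (simp add: sum.If_cases of_bool_def)
    then show "(\<Sum>e\<in>all_edges. of_bool (e \<in> S \<and> Q S) * pr (\<lambda>T. T = S)) =
        real (card S) * of_bool (Q S) * pr (\<lambda>T. T = S)"
      by (simp add: of_bool_conj mult.assoc flip: sum_distrib_right)
  qed
  finally show ?thesis .
qed

text \<open>On the event \<open>card S = Suc j\<close> the edge count is constant, so
  \<open>sum_pr_edge\<close> gives the first term as a sum over edges, to which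
  \<open>pr_edge_card\<close> applies termwise.\<close>

lemma card_recurrence:
  "\<bar>real (Suc j) * pr (\<lambda>S. card S = Suc j) - card all_edges * p * pr (\<lambda>S. card S = j)\<bar>
   \<le> card all_edges * (4 * card V * p\<^sup>2)"
proof -
  have "real (Suc j) * pr (\<lambda>S. card S = Suc j) = (\<Sum>e\<in>all_edges. pr (\<lambda>S. e \<in> S \<and> card S = Suc j))"
    unfolding sum_pr_edge[of "\<lambda>S. card S = Suc j"] pr_eq_sum[of "\<lambda>S. card S = Suc j"] sum_distrib_left
    by (intro sum.cong) auto
  then have "\<bar>real (Suc j) * pr (\<lambda>S. card S = Suc j) - card all_edges * p * pr (\<lambda>S. card S = j)\<bar>
      = \<bar>\<Sum>e\<in>all_edges. pr (\<lambda>S. e \<in> S \<and> card S = Suc j) - p * pr (\<lambda>S. card S = j)\<bar>"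
    by (simp add: sum_subtractf)
  also have "\<dots> \<le> (\<Sum>e\<in>all_edges. 4 * card V * p\<^sup>2)"
    by (rule order_trans[OF sum_abs]) (intro sum_mono pr_edge_card)
  finally show ?thesis by simp
qed

lemma pr_card_in_atMost:
  "pr (\<lambda>S. card S \<le> J \<and> b (card S)) = (\<Sum>j\<le>J. pr (\<lambda>S. card S = j) * of_bool (b j))"
proof -
  have "{\<omega> \<in> space M. card (H \<omega>) \<le> J \<and> b (card (H \<omega>))} =
      (\<Union>j\<in>{j \<in> {..J}. b j}. {\<omega> \<in> space M. card (H \<omega>) = j})" by auto
  also have "prob \<dots> = (\<Sum>j\<in>{j \<in> {..J}. b j}. pr (\<lambda>S. card S = j))"
    using event by (intro finite_measure_finite_Union) (auto simp: disjoint_family_on_def)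
  also have "\<dots> = (\<Sum>j\<le>J. pr (\<lambda>S. card S = j) * of_bool (b j))"
    by (intro sum.mono_neutral_cong_left) auto
  finally show ?thesis .
qed

lemma pr_card_gt: "pr (\<lambda>S. J < card S) = 1 - (\<Sum>j\<le>J. pr (\<lambda>S. card S = j))"
proof -
  have "pr (\<lambda>S. \<not> card S \<le> J) = 1 - pr (\<lambda>S. card S \<le> J)"
    using prob_neg[OF event[of "\<lambda>S. card S \<le> J"]] by simp
  then show ?thesis using pr_card_in_atMost[of J "\<lambda>_. True"] by (simp add: not_le)
qed

text \<open>Markov's inequality; the mean edge count comes from \<open>sum_pr_edge\<close> with the
  trivial predicate, which explains the factor \<open>of_bool True\<close> in the proof.\<close>

lemma pr_card_gt_le: "pr (\<lambda>S. J < card S) \<le> card all_edges * p / real (Suc J)"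
proof -
  have "real (Suc J) * pr (\<lambda>S. J < card S) \<le> (\<Sum>S\<in>Pow all_edges. real (card S) * of_bool True * pr (\<lambda>T. T = S))"
    by (subst pr_eq_sum, subst sum_distrib_left, intro sum_mono)
      (auto intro!: mult_right_mono)
  also have "\<dots> = card all_edges * p"
    unfolding sum_pr_edge[symmetric] by (simp add: pr_edge)
  finally show ?thesis by (simp add: field_simps)
qed

text \<open>\<open>Q\<close> can differ from a condition on the edge count only if two edges meet or
  there are more than \<open>J\<close> edges; the two error terms bound these events.\<close>

lemma pr_approx:
  assumes "\<And>S. S \<subseteq> all_edges \<Longrightarrow> pairwise disjnt S \<Longrightarrow> card S \<le> J \<Longrightarrow> Q S \<longleftrightarrow> b (card S)"
  shows "\<bar>pr Q - (\<Sum>j\<le>J. pr (\<lambda>S. card S = j) * of_bool (b j))\<bar>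
    \<le> card all_edges * (2 * card V * p\<^sup>2) + card all_edges * p / real (Suc J)"
proof -
  have "\<bar>pr Q - pr (\<lambda>S. card S \<le> J \<and> b (card S))\<bar> \<le> pr (\<lambda>S. \<not> pairwise disjnt S \<or> J < card S)"
    using assms by (intro abs_pr_diff_le) (meson not_le)
  also have "\<dots> \<le> pr (\<lambda>S. \<not> pairwise disjnt S) + pr (\<lambda>S. J < card S)"
    by (rule pr_le_add)
  finally show ?thesis
    using pr_not_matching_le pr_card_gt_le[of J] by (simp add: pr_card_in_atMost)
qed

end

section \<open>Interchange of limits and the Poisson limit\<close>

lemma tendsto_of_approximations:
  fixes x :: "nat \<Rightarrow> real"
  assumes s: "\<And>J. (\<lambda>n. s n J) \<longlonglongrightarrow> s' J" and s': "s' \<longlonglongrightarrow> L"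
    and d: "\<And>J. (\<lambda>n. d n J) \<longlonglongrightarrow> d' J" and d': "d' \<longlonglongrightarrow> 0"
    and le: "\<And>J. \<forall>\<^sub>F n in sequentially. \<bar>x n - s n J\<bar> \<le> d n J"
  shows "x \<longlonglongrightarrow> L"
proof (rule tendstoI)
  fix \<epsilon> :: real assume \<epsilon>: "\<epsilon> > 0"
  \<comment> \<open>The cutoff \<open>J\<close> is fixed first, by the limits in \<open>n\<close>;
    only then is \<open>n\<close> taken large. The error \<open>d n J\<close> uses two of the four
    quarters.\<close>
  have "\<forall>\<^sub>F J in sequentially. dist (s' J) L < \<epsilon> / 4 \<and> dist (d' J) 0 < \<epsilon> / 4"
    using \<epsilon> by (intro eventually_conj tendstoD[OF s'] tendstoD[OF d']) auto
  then obtain J where J: "dist (s' J) L < \<epsilon> / 4" "dist (d' J) 0 < \<epsilon> / 4"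
    by (auto simp: eventually_sequentially)
  have "\<forall>\<^sub>F n in sequentially. dist (s n J) (s' J) < \<epsilon> / 4" "\<forall>\<^sub>F n in sequentially. dist (d n J) (d' J) < \<epsilon> / 4"
    using \<epsilon> by (intro tendstoD[OF s] tendstoD[OF d]; simp)+
  with le[of J] show "\<forall>\<^sub>F n in sequentially. dist (x n) L < \<epsilon>"
    by eventually_elim (use J in \<open>unfold dist_real_def, linarith\<close>)
qed

text \<open>The size-bias recurrence determines all limits up to the factor \<open>q n 0\<close>, which is then
  fixed by the tail bound.\<close>

lemma poisson_limit:
  fixes q :: "nat \<Rightarrow> nat \<Rightarrow> real"
  assumes q01: "\<And>n j. 0 \<le> q n j" "\<And>n j. q n j \<le> 1"
    and rec: "\<And>j. (\<lambda>n. real (Suc j) * q n (Suc j) - m n * q n j) \<longlonglongrightarrow> 0"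
    and m: "m \<longlonglongrightarrow> lam" and lam: "0 \<le> lam"
    and tail: "\<And>n J. \<bar>1 - (\<Sum>j\<le>J. q n j)\<bar> \<le> m n / real (Suc J)"
  shows "(\<lambda>n. q n j) \<longlonglongrightarrow> exp (- lam) * lam ^ j / fact j"
proof -
  have bdd: "Bfun (\<lambda>n. q n j) sequentially" for j
    using q01 by (intro BfunI[where K = 1] always_eventually) (simp add: abs_le_iff)
  have ratio: "(\<lambda>n. q n j - lam ^ j / fact j * q n 0) \<longlonglongrightarrow> 0" for j
  proof (induction j)
    case (Suc j)
    \<comment> \<open>Boundedness of \<open>q\<close> allows \<open>m n\<close> in the recurrence to
      be replaced by its limit.\<close>
    have "(\<lambda>n. (m n - lam) * q n j) \<longlonglongrightarrow> 0"
    proof -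
      have "Zfun (\<lambda>n. m n - lam) sequentially" using m by (simp add: tendsto_Zfun_iff)
      then have "Zfun (\<lambda>n. (m n - lam) * q n j) sequentially"
        using bdd[of j] by (rule bounded_bilinear.Zfun_prod_Bfun[OF bounded_bilinear_mult])
      then show ?thesis by (simp add: tendsto_Zfun_iff)
    qed
    from tendsto_add[OF rec[of j] this]
    have "(\<lambda>n. real (Suc j) * q n (Suc j) - lam * q n j) \<longlonglongrightarrow> 0"
      by (simp add: algebra_simps)
    from tendsto_add[OF this tendsto_mult_left[OF Suc.IH, of lam]]
    have "(\<lambda>n. real (Suc j) * q n (Suc j) - lam * (lam ^ j / fact j) * q n 0) \<longlonglongrightarrow> 0"
      by (simp add: algebra_simps)
    from tendsto_mult_left[OF this, of "1 / real (Suc j)"]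
    show ?case by (simp add: field_simps del: of_nat_Suc)
  qed simp
  define E where "E J = (\<Sum>j\<le>J. lam ^ j / fact j)" for J
  have E_ge_1: "1 \<le> E J" for J
    using sum_mono2[of "{..J}" "{0}" "\<lambda>j. lam ^ j / fact j"] lam by (simp add: E_def)
  \<comment> \<open>The sum of \<open>q n j\<close> over \<open>j \<le> J\<close> is close to
    \<open>E J * q n 0\<close> by \<open>ratio\<close> and close to 1 by \<open>tail\<close>; hence
    \<open>q n 0\<close> is approximately \<open>1 / E J\<close>, where \<open>E J\<close> is a
    partial sum of \<open>exp lam\<close>.\<close>
  have "(\<lambda>n. q n 0) \<longlonglongrightarrow> exp (- lam)"
  proof (rule tendsto_of_approximations)
    show "(\<lambda>n. 1 / E J) \<longlonglongrightarrow> 1 / E J" for J by simp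
    have "E \<longlonglongrightarrow> exp lam"
      using summable_exp_generic[of lam] unfolding E_def exp_def
      by (simp add: summable_LIMSEQ' divide_inverse mult.commute)
    from tendsto_divide[OF tendsto_const[of 1] this] show "(\<lambda>J. 1 / E J) \<longlonglongrightarrow> exp (- lam)"
      by (simp add: exp_minus divide_inverse)
    show "(\<lambda>n. \<bar>\<Sum>j\<le>J. q n j - lam ^ j / fact j * q n 0\<bar> + m n / real (Suc J)) \<longlonglongrightarrow> lam / real (Suc J)" for J
    proof -
      have "(\<lambda>n. \<bar>\<Sum>j\<le>J. q n j - lam ^ j / fact j * q n 0\<bar> + m n / real (Suc J))
          \<longlonglongrightarrow> \<bar>\<Sum>j\<le>J. 0\<bar> + lam / real (Suc J)"
        by (intro tendsto_intros ratio m) simp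
      then show ?thesis by simp
    qed
    show "(\<lambda>J. lam / real (Suc J)) \<longlonglongrightarrow> 0"
      using tendsto_mult_left[OF LIMSEQ_inverse_real_of_nat, of lam] by (simp add: divide_inverse)
    show "\<forall>\<^sub>F n in sequentially. \<bar>q n 0 - 1 / E J\<bar>
        \<le> \<bar>\<Sum>j\<le>J. q n j - lam ^ j / fact j * q n 0\<bar> + m n / real (Suc J)" for J
    proof (rule always_eventually, rule allI)
      fix n
      \<comment> \<open>Since \<open>E J\<close> is at least 1, the denominator can be cleared
        without a further constant.\<close>
      have "\<bar>q n 0 - 1 / E J\<bar> \<le> E J * \<bar>q n 0 - 1 / E J\<bar>"
        using mult_right_mono[OF E_ge_1[of J], of "\<bar>q n 0 - 1 / E J\<bar>"] by simp
      also have "\<dots> = \<bar>E J * q n 0 - 1\<bar>"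
        using E_ge_1[of J] abs_mult[of "E J" "q n 0 - 1 / E J"] by (simp add: right_diff_distrib)
      also have "E J * q n 0 = (\<Sum>j\<le>J. q n j) - (\<Sum>j\<le>J. q n j - lam ^ j / fact j * q n 0)"
        by (simp add: sum_subtractf E_def sum_distrib_right)
      finally show "\<bar>q n 0 - 1 / E J\<bar>
          \<le> \<bar>\<Sum>j\<le>J. q n j - lam ^ j / fact j * q n 0\<bar> + m n / real (Suc J)"
        using tail[of n J] by linarith
    qed
  qed
  from tendsto_add[OF ratio[of j] tendsto_mult_left[OF this, of "lam ^ j / fact j"]]
  show ?thesis by (simp add: mult.commute)
qed

section \<open>Balls in the torus\<close>

text \<open>\<open>rep_circle\<close> picks an unspecified real in each class. Its fractional part
  is determined by the class and lies in the fundamental domain \<open>{0..<1}\<close>, which makes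
  measurability provable.\<close>

definition circle_repr :: "circle \<Rightarrow> real" where
  "circle_repr c = frac (rep_circle c)"

lemma abs_circle_eq_iff: "abs_circle s = abs_circle t \<longleftrightarrow> (\<exists>m::int. s - t = of_int m)"
  by (rule circle.abs_eq_iff)

lemma circle_repr_abs: "circle_repr (abs_circle t) = frac t"
proof -
  have "abs_circle (rep_circle (abs_circle t)) = abs_circle t"
    by (rule Quotient_abs_rep[OF Quotient_circle])
  then obtain m :: int where "rep_circle (abs_circle t) = t + of_int m"
    unfolding abs_circle_eq_iff by (auto simp: algebra_simps)
  then show ?thesis by (simp add: circle_repr_def frac_def)
qed

lemma abs_circle_repr: "abs_circle (circle_repr c) = c"
proof -
  have "abs_circle (circle_repr c) = abs_circle (rep_circle c)"
    unfolding abs_circle_eq_iff circle_repr_def frac_def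
    by (rule exI[of _ "- \<lfloor>rep_circle c\<rfloor>"]) simp
  then show ?thesis by (simp add: Quotient_abs_rep[OF Quotient_circle])
qed

lemma circle_repr_range: "circle_repr c \<in> {0..<1}"
  by (simp add: circle_repr_def frac_lt_1)

lemma sets_circle_uniform [measurable_cong]: "sets circle_uniform = sets circle_space"
  by (simp add: circle_uniform_def)

lemma space_circle_uniform [simp]: "space circle_uniform = UNIV"
  by (simp add: circle_uniform_def)

lemma measurable_circle_repr [measurable]: "circle_repr \<in> borel_measurable circle_space"
proof (rule measurableI)
  fix B :: "real set" assume [measurable]: "B \<in> sets borel"
  have "(\<lambda>t::real. t - of_int \<lfloor>t\<rfloor>) -` B \<inter> space borel \<in> sets borel"
    by (rule measurable_sets[OF _ \<open>B \<in> sets borel\<close>]) measurable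
  moreover have "abs_circle -` (circle_repr -` B \<inter> space circle_space) = (\<lambda>t::real. t - of_int \<lfloor>t\<rfloor>) -` B"
    by (auto simp: circle_repr_abs frac_def)
  ultimately show "circle_repr -` B \<inter> space circle_space \<in> sets circle_space"
    by (simp add: sets_circle_space)
qed simp

text \<open>Because the minimum is attained, the bound becomes a countable existential over
  integers, a form suited to measurability proofs.\<close>

lemma circle_norm_abs_le_iff:
  "circle_norm (abs_circle t) \<le> r \<longleftrightarrow> (\<exists>m::int. \<bar>t - of_int m\<bar> \<le> r)"
proof -
  obtain m :: int where m: "circle_norm (abs_circle t) = \<bar>t - of_int m\<bar>"
    "\<And>k::int. \<bar>t - of_int m\<bar> \<le> \<bar>t - of_int k\<bar>"
    using circle_norm_attained[of t] by blast
  show ?thesis unfolding m(1) using m(2) order_trans by blast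
qed

lemma circle_diff_abs: "c - d = abs_circle (circle_repr c - circle_repr d)"
proof -
  have "c - d = abs_circle (circle_repr c) - abs_circle (circle_repr d)"
    by (simp only: abs_circle_repr)
  also have "\<dots> = abs_circle (circle_repr c - circle_repr d)"
    by (simp add: minus_circle_def uminus_circle.abs_eq plus_circle.abs_eq)
  finally show ?thesis .
qed

lemma circle_dist_le_measurable [measurable]:
  "Measurable.pred (circle_space \<Otimes>\<^sub>M circle_space) (\<lambda>(c, d). circle_norm (c - d) \<le> r)"
  unfolding circle_diff_abs circle_norm_abs_le_iff by measurable

text \<open>Cut open at 0, the arc about \<open>y\<close> is one interval of length
  \<open>2 * r\<close>, or two intervals if it crosses an end of \<open>{0..<1}\<close>. The value
  does not depend on the centre.\<close>

lemma emeasure_circle_ball: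
  assumes "0 \<le> r" "r \<le> 1 / 2"
  shows "emeasure circle_uniform {c. circle_norm (c - d) \<le> r} = ennreal (2 * r)"
proof -
  define y where "y = circle_repr d"
  have y: "0 \<le> y" "y < 1" using circle_repr_range[of d] by (auto simp: y_def)
  have "(\<lambda>c. (c, d)) \<in> circle_space \<rightarrow>\<^sub>M circle_space \<Otimes>\<^sub>M circle_space" by simp
  from measurable_compose[OF this circle_dist_le_measurable[of r]]
  have ball: "{c. circle_norm (c - d) \<le> r} \<in> sets circle_space" by (simp add: pred_def)
  have vim: "abs_circle -` {c. circle_norm (c - d) \<le> r} = {t. \<exists>m::int. \<bar>t - y - of_int m\<bar> \<le> r}"
    unfolding y_def
  proof (intro set_eqI)
    fix t
    have "abs_circle t - d = abs_circle (t - circle_repr d)"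
      by (subst abs_circle_repr[of d, symmetric])
        (simp only: minus_circle_def uminus_circle.abs_eq plus_circle.abs_eq diff_conv_add_uminus)
    then show "t \<in> abs_circle -` {c. circle_norm (c - d) \<le> r} \<longleftrightarrow>
        t \<in> {t. \<exists>m::int. \<bar>t - circle_repr d - of_int m\<bar> \<le> r}"
      by (simp add: circle_norm_abs_le_iff)
  qed
  \<comment> \<open>Both \<open>t\<close> and \<open>y\<close> lie in the unit interval and
    \<open>r\<close> is at most one half, so larger shifts cannot occur.\<close>
  have m_cases: "m \<in> {-1, 0, 1}" if "\<bar>t - y - of_int m\<bar> \<le> r" "t \<in> {0..<1}" for t and m :: int
  proof -
    have "of_int m < (2::real)" "of_int m > (-2::real)" using that y assms by (auto simp: abs_le_iff)
    then show ?thesis by auto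
  qed
  have set_eq: "{t. \<exists>m::int. \<bar>t - y - of_int m\<bar> \<le> r} \<inter> {0..<1} =
    {t \<in> {0..<1}. \<bar>t - y\<bar> \<le> r \<or> \<bar>t - y - 1\<bar> \<le> r \<or> \<bar>t - y + 1\<bar> \<le> r}" (is "?L = ?R")
  proof (intro equalityI subsetI)
    fix t assume "t \<in> ?L"
    then obtain m :: int where m: "\<bar>t - y - of_int m\<bar> \<le> r" "t \<in> {0..<1}" by blast
    then show "t \<in> ?R" using m_cases[OF m] by auto
  next
    fix t assume t: "t \<in> ?R"
    have "\<bar>t - y - of_int 0\<bar> \<le> r \<or> \<bar>t - y - of_int 1\<bar> \<le> r \<or> \<bar>t - y - of_int (-1)\<bar> \<le> r"
      using t by simp
    then show "t \<in> ?L" using t by blast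
  qed
  have "emeasure lborel ?R = ennreal (2 * r)"
  \<comment> \<open>For \<open>r = 1 / 2\<close> the arc is the whole circle and its two closed ends
    coincide, so the decompositions into disjoint intervals used below would overlap in a
    point.\<close>
  proof (cases "r = 1 / 2")
    case True
    have "?R = {0..<1}" using y by (auto simp: True abs_real_def)
    then show ?thesis by (simp add: True)
  next
    case False
    then have r: "r < 1 / 2" using assms by simp
    consider "y < r" | "r \<le> y" "y + r < 1" | "1 \<le> y + r" by linarith
    then show ?thesis
    proof cases
      case 1
      then have "?R = {0..y + r} \<union> {y - r + 1..<1}" using r y by (auto simp: abs_le_iff)
      moreover have "emeasure lborel ({0..y + r} \<union> {y - r + 1..<1}) = ennreal (y + r) + ennreal (r - y)"
        using r y 1 by (subst plus_emeasure[symmetric]) auto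
      ultimately show ?thesis using y assms 1 by (simp flip: ennreal_plus)
    next
      case 2
      then have "?R = {y - r..y + r}" using r y by (auto simp: abs_le_iff)
      then show ?thesis using assms by simp
    next
      case 3
      then have "?R = {0..y + r - 1} \<union> {y - r..<1}" using r y by (auto simp: abs_le_iff)
      moreover have "emeasure lborel ({0..y + r - 1} \<union> {y - r..<1}) = ennreal (y + r - 1) + ennreal (1 - (y - r))"
        using r y 3 by (subst plus_emeasure[symmetric]) auto
      ultimately show ?thesis using y assms 3 by (simp flip: ennreal_plus)
    qed
  qed
  then have "emeasure lborel ({0..<1} \<inter> abs_circle -` {c. circle_norm (c - d) \<le> r}) = ennreal (2 * r)"
    unfolding vim Int_commute[of "{0..<1}"] set_eq .
  moreover have "abs_circle -` {c. circle_norm (c - d) \<le> r} \<in> sets borel"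
    using ball by (simp add: sets_circle_space)
  ultimately show ?thesis
    using ball by (simp add: circle_uniform_def emeasure_distr emeasure_uniform_measure divide_ennreal_def)
qed

section \<open>Balls of the maximum metric\<close>

lemma torus_dist_le_iff:
  assumes "D \<ge> 1"
  shows "torus_dist D x y \<le> r \<longleftrightarrow> (\<forall>i\<in>{1..D}. circle_norm (x i - y i) \<le> r)"
  using assms by (simp add: torus_dist_def)

lemma circle_norm_minus_commute: "circle_norm (c - d) = circle_norm (d - c)"
proof -
  have "circle_norm (c - d) \<le> circle_norm (d - c)" for c d
  proof -
    obtain m :: int where "\<bar>circle_repr d - circle_repr c - of_int m\<bar> \<le> circle_norm (d - c)"
      using circle_norm_abs_le_iff[of "circle_repr d - circle_repr c" "circle_norm (d - c)"]
      by (auto simp flip: circle_diff_abs)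
    then have "\<bar>circle_repr c - circle_repr d - of_int (- m)\<bar> \<le> circle_norm (d - c)" by simp
    then show ?thesis
      unfolding circle_diff_abs[of c d] circle_norm_abs_le_iff by blast
  qed
  then show ?thesis by (simp add: order_antisym)
qed

lemma torus_dist_commute: "torus_dist D x y = torus_dist D y x"
  unfolding torus_dist_def by (subst circle_norm_minus_commute) (rule refl)

lemma torus_dist_le_measurable [measurable]:
  assumes "D \<ge> 1"
  shows "Measurable.pred (torus_uniform D \<Otimes>\<^sub>M torus_uniform D) (\<lambda>(x, y). torus_dist D x y \<le> r)"
proof -
  have "Measurable.pred (torus_uniform D \<Otimes>\<^sub>M torus_uniform D) (\<lambda>z. circle_norm (fst z i - snd z i) \<le> r)"
    if "i \<in> {1..D}" for i
  proof -
    have "(\<lambda>x. x i) \<in> torus_uniform D \<rightarrow>\<^sub>M circle_space"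
      using measurable_component_singleton[OF that, of "\<lambda>_. circle_uniform"]
      by (simp add: torus_uniform_def cong: measurable_cong_sets sets_circle_uniform)
    note [measurable] = this
    have "(\<lambda>z. (fst z i, snd z i)) \<in> torus_uniform D \<Otimes>\<^sub>M torus_uniform D \<rightarrow>\<^sub>M circle_space \<Otimes>\<^sub>M circle_space"
      by measurable
    from measurable_compose[OF this circle_dist_le_measurable[of r]] show ?thesis by simp
  qed
  then have "Measurable.pred (torus_uniform D \<Otimes>\<^sub>M torus_uniform D)
      (\<lambda>z. \<forall>i\<in>{1..D}. circle_norm (fst z i - snd z i) \<le> r)"
    by (intro pred_intros_finite) auto
  then show ?thesis
    by (simp add: torus_dist_le_iff[OF assms] split_beta')
qed

text \<open>A ball of the maximum metric is a product of arcs of equal length. Its volume is the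
  same for every centre, and this is the source of the independence of edges.\<close>

lemma emeasure_torus_ball:
  assumes "D \<ge> 1" "0 \<le> r" "r \<le> 1 / 2"
  shows "emeasure (torus_uniform D) {x \<in> space (torus_uniform D). torus_dist D x y \<le> r} = ennreal ((2 * r) ^ D)"
proof -
  interpret product_prob_space "\<lambda>_. circle_uniform" "{1..D}"
    unfolding product_prob_space_def product_prob_space_axioms_def product_sigma_finite_def
    by (simp add: prob_space_circle_uniform prob_space_imp_sigma_finite)
  have "(\<lambda>c. (c, d)) \<in> circle_space \<rightarrow>\<^sub>M circle_space \<Otimes>\<^sub>M circle_space" for d by simp
  from measurable_compose[OF this circle_dist_le_measurable[of r]]
  have ball: "{c. circle_norm (c - d) \<le> r} \<in> sets circle_uniform" for d
    by (simp add: pred_def sets_circle_uniform)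
  have "{x \<in> space (torus_uniform D). torus_dist D x y \<le> r} = (\<Pi>\<^sub>E i\<in>{1..D}. {c. circle_norm (c - y i) \<le> r})"
    by (rule set_eqI) (simp only: mem_Collect_eq torus_uniform_def space_PiM
      torus_dist_le_iff[OF assms(1)] PiE_iff space_circle_uniform UNIV_I, blast)
  also have "emeasure (torus_uniform D) \<dots> = (\<Prod>i\<in>{1..D}. ennreal (2 * r))"
    unfolding torus_uniform_def using ball assms
    by (subst emeasure_PiM) (simp_all add: emeasure_circle_ball)
  finally show ?thesis using assms by (simp add: ennreal_power)
qed

section \<open>The random geometric graph\<close>

lemma geometric_graph_edge_iff:
  "{u, v} \<in> snd (geometric_graph D n r x) \<longleftrightarrow>
   u \<in> {1..n} \<and> v \<in> {1..n} \<and> u \<noteq> v \<and> torus_dist D (x u) (x v) \<le> r"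
  unfolding geometric_graph_def snd_conv mem_Collect_eq doubleton_eq_iff
  using torus_dist_commute by metis

text \<open>Given all points except \<open>X v\<close>, the point \<open>X v\<close> is still
  uniform, and the edge to \<open>u\<close> requires it to hit a ball whose volume does not depend
  on the given points. The proof makes this precise by a product law and integration over
  \<open>X v\<close> first.\<close>

lemma random_edge_set_geometric_graph:
  fixes M :: "'w measure" and X :: "nat \<Rightarrow> 'w \<Rightarrow> nat \<Rightarrow> circle"
  assumes "prob_space M" and indep: "prob_space.indep_vars M (\<lambda>_. torus_uniform D) X {1..n}"
    and dist: "\<And>i. i \<in> {1..n} \<Longrightarrow> distr M (torus_uniform D) (X i) = torus_uniform D"
    and D: "D \<ge> 1" and r: "0 \<le> r" "r \<le> 1 / 2"
  shows "random_edge_set M {1..n} (\<lambda>\<omega>. snd (geometric_graph D n r (\<lambda>i. X i \<omega>))) ((2 * r) ^ D)"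
proof -
  interpret prob_space M by fact
  define T where "T = torus_uniform D"
  interpret T: prob_space T unfolding T_def by (rule prob_space_torus_uniform)
  define H where "H \<omega> = snd (geometric_graph D n r (\<lambda>i. X i \<omega>))" for \<omega>
  have H_iff: "{u, v} \<in> H \<omega> \<longleftrightarrow> u \<in> {1..n} \<and> v \<in> {1..n} \<and> u \<noteq> v \<and> torus_dist D (X u \<omega>) (X v \<omega>) \<le> r" for u v \<omega>
    unfolding H_def by (rule geometric_graph_edge_iff)
  have X [measurable]: "X i \<in> M \<rightarrow>\<^sub>M T" if "i \<in> {1..n}" for i
    using indep that by (auto simp: indep_vars_def T_def)
  have pred: "Measurable.pred N (\<lambda>\<omega>. torus_dist D (f \<omega>) (g \<omega>) \<le> r)"
    if "f \<in> N \<rightarrow>\<^sub>M T" "g \<in> N \<rightarrow>\<^sub>M T" for N :: "'x measure" and f g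
    using measurable_compose[OF measurable_Pair[OF that] torus_dist_le_measurable[OF D, of r, folded T_def]] by simp
  show ?thesis
    unfolding H_def[symmetric]
  proof unfold_locales
    show "H \<omega> \<subseteq> {e. e \<subseteq> {1..n} \<and> card e = 2}" for \<omega>
      using simple_graph_geometric_graph[of D n r "\<lambda>i. X i \<omega>"]
      by (auto simp: simple_graph_def H_def geometric_graph_def)
    show "{\<omega> \<in> space M. {u, v} \<in> H \<omega>} \<in> events" if uv: "u \<in> {1..n}" "v \<in> {1..n}" for u v
      unfolding H_iff using pred[OF X[OF uv(1)] X[OF uv(2)]] uv
      by (cases "u = v") (simp_all add: pred_def)
    show "prob {\<omega> \<in> space M. {u, v} \<in> H \<omega> \<and> Q {e \<in> H \<omega>. v \<notin> e}} =
      (2 * r) ^ D * prob {\<omega> \<in> space M. Q {e \<in> H \<omega>. v \<notin> e}}"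
      if u: "u \<in> {1..n}" and v: "v \<in> {1..n}" and "u \<noteq> v" for u v Q
    proof -
      define I where "I = {1..n} - {v}"
      \<comment> \<open>\<open>Z\<close> collects the points other than \<open>X v\<close>,
        \<open>N\<close> is its law, and \<open>F\<close> rebuilds from such a configuration the
        edges avoiding \<open>v\<close>.\<close>
      define Z where "Z \<omega> = restrict (\<lambda>i. X i \<omega>) I" for \<omega>
      define N where "N = distr M (PiM I (\<lambda>_. T)) Z"
      define F where "F z = {{i, j} | i j. i \<in> I \<and> j \<in> I \<and> i \<noteq> j \<and> torus_dist D (z i) (z j) \<le> r}"
        for z :: "nat \<Rightarrow> nat \<Rightarrow> circle"
      have uI: "u \<in> I" and I: "I \<subseteq> {1..n}" using u \<open>u \<noteq> v\<close> by (auto simp: I_def)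
      have Z [measurable]: "Z \<in> M \<rightarrow>\<^sub>M PiM I (\<lambda>_. T)"
        unfolding Z_def using X I by (intro measurable_restrict) auto
      have sets_N [measurable_cong]: "sets N = sets (PiM I (\<lambda>_. T))" by (simp add: N_def)
      interpret N: prob_space N unfolding N_def by (rule prob_space_distr) (rule Z)
      have comp: "(\<lambda>z. z i) \<in> N \<rightarrow>\<^sub>M T" if "i \<in> I" for i
        using that by (simp cong: measurable_cong_sets add: sets_N)
      have FZ: "{e \<in> H \<omega>. v \<notin> e} = F (Z \<omega>)" for \<omega>
      proof -
        have "{e \<in> H \<omega>. v \<notin> e} = {{i, j} | i j. (i \<in> {1..n} \<and> j \<in> {1..n} \<and> i \<noteq> j \<and>
            torus_dist D (X i \<omega>) (X j \<omega>) \<le> r) \<and> v \<noteq> i \<and> v \<noteq> j}"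
          unfolding H_def geometric_graph_def snd_conv by blast
        also have "\<dots> = F (Z \<omega>)"
          unfolding F_def by (intro Collect_cong ex_cong1) (auto simp: Z_def I_def)
        finally show ?thesis .
      qed
      have B: "{z \<in> space N. Q (F z)} \<in> sets N"
      proof (rule sets_Collect_finite_set_valued)
        show "finite ((\<lambda>(i, j). {i, j}) ` {(i, j) \<in> I \<times> I. i \<noteq> j})"
          by (intro finite_imageI, rule finite_subset[of _ "{1..n} \<times> {1..n}"]) (use I in auto)
        show "F z \<subseteq> (\<lambda>(i, j). {i, j}) ` {(i, j) \<in> I \<times> I. i \<noteq> j}" for z
          unfolding F_def by auto
        fix e assume "e \<in> (\<lambda>(i, j). {i, j}) ` {(i, j) \<in> I \<times> I. i \<noteq> j}"
        then obtain i j where ij: "e = {i, j}" "i \<in> I" "j \<in> I" "i \<noteq> j" by auto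
        have "e \<in> F z \<longleftrightarrow> torus_dist D (z i) (z j) \<le> r" for z
          unfolding F_def ij(1) mem_Collect_eq doubleton_eq_iff using ij(2-4) torus_dist_commute by metis
        then show "{z \<in> space N. e \<in> F z} \<in> sets N"
          using pred[OF comp[OF ij(2)] comp[OF ij(3)]] by (simp add: pred_def)
      qed
      define A where "A = {w \<in> space (N \<Otimes>\<^sub>M T). Q (F (fst w)) \<and> torus_dist D (snd w) (fst w u) \<le> r}"
      have A: "A \<in> sets (N \<Otimes>\<^sub>M T)"
      proof -
        have "{w \<in> space (N \<Otimes>\<^sub>M T). Q (F (fst w))} = fst -` {z \<in> space N. Q (F z)} \<inter> space (N \<Otimes>\<^sub>M T)"
          by (auto simp: space_pair_measure)
        also have "\<dots> \<in> sets (N \<Otimes>\<^sub>M T)" using B by (rule measurable_sets[OF measurable_fst])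
        finally have "{w \<in> space (N \<Otimes>\<^sub>M T). Q (F (fst w))} \<in> sets (N \<Otimes>\<^sub>M T)" .
        moreover have "{w \<in> space (N \<Otimes>\<^sub>M T). torus_dist D (snd w) (fst w u) \<le> r} \<in> sets (N \<Otimes>\<^sub>M T)"
          using pred[OF measurable_snd[of N T] measurable_compose[OF measurable_fst comp[OF uI]]]
          by (simp add: pred_def)
        ultimately have "{w \<in> space (N \<Otimes>\<^sub>M T). Q (F (fst w))} \<inter> {w \<in> space (N \<Otimes>\<^sub>M T). torus_dist D (snd w) (fst w u) \<le> r} \<in> sets (N \<Otimes>\<^sub>M T)"
          by (rule sets.Int)
        moreover have "A = {w \<in> space (N \<Otimes>\<^sub>M T). Q (F (fst w))} \<inter> {w \<in> space (N \<Otimes>\<^sub>M T). torus_dist D (snd w) (fst w u) \<le> r}"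
          unfolding A_def by blast
        ultimately show ?thesis by simp
      qed
      \<comment> \<open>Independence of disjoint subfamilies treats \<open>X v\<close> as the
        one-coordinate family \<open>Y\<close>; projecting to the coordinate \<open>v\<close> then
        replaces its law \<open>S\<close> by \<open>T\<close>.\<close>
      have joint: "distr M (N \<Otimes>\<^sub>M T) (\<lambda>\<omega>. (Z \<omega>, X v \<omega>)) = N \<Otimes>\<^sub>M T"
      proof -
        define Y where "Y \<omega> = restrict (\<lambda>i. X i \<omega>) {v}" for \<omega>
        define S where "S = distr M (PiM {v} (\<lambda>_. T)) Y"
        have "indep_var (PiM I (\<lambda>_. T)) Z (PiM {v} (\<lambda>_. T)) (\<lambda>\<omega>. restrict (\<lambda>i. X i \<omega>) {v})"
          unfolding Z_def using indep v unfolding T_def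
          by (intro indep_var_restrict[of "\<lambda>_. torus_uniform D" X "{1..n}"]) (auto simp: I_def)
        then have "N \<Otimes>\<^sub>M S = distr M (PiM I (\<lambda>_. T) \<Otimes>\<^sub>M PiM {v} (\<lambda>_. T)) (\<lambda>\<omega>. (Z \<omega>, Y \<omega>))"
          by (simp add: indep_var_distribution_eq N_def S_def Y_def[abs_def])
        \<comment> \<open>\<open>distr\<close> sees only the sigma-algebra of its target, so the
          target may be rewritten to compose with the projection.\<close>
        also have "\<dots> = distr M (N \<Otimes>\<^sub>M S) (\<lambda>\<omega>. (Z \<omega>, Y \<omega>))"
          by (intro distr_cong refl sets_pair_measure_cong) (simp_all add: sets_N S_def)
        finally have NS: "N \<Otimes>\<^sub>M S = distr M (N \<Otimes>\<^sub>M S) (\<lambda>\<omega>. (Z \<omega>, Y \<omega>))" .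
        have Y: "Y \<in> M \<rightarrow>\<^sub>M PiM {v} (\<lambda>_. T)"
          unfolding Y_def using X v by (intro measurable_restrict) auto
        have proj: "(\<lambda>y. y v) \<in> S \<rightarrow>\<^sub>M T" by (simp add: S_def)
        have "distr S T (\<lambda>y. y v) = distr M T (\<lambda>\<omega>. Y \<omega> v)"
          unfolding S_def using Y by (subst distr_distr) (auto simp: comp_def)
        also have "\<dots> = T" using dist[OF v] by (simp add: T_def Y_def)
        finally have S_T: "distr S T (\<lambda>y. y v) = T" .
        have "N \<Otimes>\<^sub>M T = distr N N (\<lambda>z. z) \<Otimes>\<^sub>M distr S T (\<lambda>y. y v)"
          by (simp add: S_T distr_id2)
        also have "\<dots> = distr (N \<Otimes>\<^sub>M S) (N \<Otimes>\<^sub>M T) (\<lambda>(z, y). (z, y v))"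
          by (rule pair_measure_distr) (simp_all add: proj S_T T.sigma_finite_measure_axioms)
        also have "\<dots> = distr M (N \<Otimes>\<^sub>M T) ((\<lambda>(z, y). (z, y v)) \<circ> (\<lambda>\<omega>. (Z \<omega>, Y \<omega>)))"
        proof (subst NS, rule distr_distr)
          show "(\<lambda>(z, y). (z, y v)) \<in> N \<Otimes>\<^sub>M S \<rightarrow>\<^sub>M N \<Otimes>\<^sub>M T"
            using proj by measurable
          show "(\<lambda>\<omega>. (Z \<omega>, Y \<omega>)) \<in> M \<rightarrow>\<^sub>M N \<Otimes>\<^sub>M S"
            using Z Y by (intro measurable_Pair) (simp_all cong: measurable_cong_sets add: sets_N S_def)
        qed
        also have "(\<lambda>(z, y). (z, y v)) \<circ> (\<lambda>\<omega>. (Z \<omega>, Y \<omega>)) = (\<lambda>\<omega>. (Z \<omega>, X v \<omega>))"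
          by (simp add: fun_eq_iff Y_def)
        finally show ?thesis by simp
      qed
      have pair: "(\<lambda>\<omega>. (Z \<omega>, X v \<omega>)) \<in> M \<rightarrow>\<^sub>M N \<Otimes>\<^sub>M T"
        using Z X[OF v] by (intro measurable_Pair) (simp_all cong: measurable_cong_sets add: sets_N)
      have "emeasure M {\<omega> \<in> space M. {u, v} \<in> H \<omega> \<and> Q {e \<in> H \<omega>. v \<notin> e}} =
          emeasure M ((\<lambda>\<omega>. (Z \<omega>, X v \<omega>)) -` A \<inter> space M)"
        using measurable_space[OF pair] uI u v \<open>u \<noteq> v\<close>
        by (intro arg_cong[where f = "emeasure M"])
          (auto simp: A_def FZ H_iff Z_def[of _] torus_dist_commute[of D "X u _"])
      also have "\<dots> = emeasure (N \<Otimes>\<^sub>M T) A"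
        using emeasure_distr[OF pair A] joint by simp
      also have "\<dots> = (\<integral>\<^sup>+z. emeasure T (Pair z -` A) \<partial>N)"
        by (rule T.emeasure_pair_measure_alt[OF A])
      \<comment> \<open>The section of \<open>A\<close> at \<open>z\<close> is the ball about
        \<open>z u\<close> if \<open>Q (F z)\<close> holds and is empty otherwise.\<close>
      also have "\<dots> = (\<integral>\<^sup>+z. ennreal ((2 * r) ^ D) * indicator {z \<in> space N. Q (F z)} z \<partial>N)"
      proof (rule nn_integral_cong)
        fix z assume "z \<in> space N"
        then have "Pair z -` A = (if Q (F z) then {x \<in> space T. torus_dist D x (z u) \<le> r} else {})"
          by (auto simp: A_def space_pair_measure)
        then show "emeasure T (Pair z -` A) = ennreal ((2 * r) ^ D) * indicator {z \<in> space N. Q (F z)} z"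
          using \<open>z \<in> space N\<close> emeasure_torus_ball[OF D r] by (simp add: T_def)
      qed
      also have "\<dots> = ennreal ((2 * r) ^ D) * emeasure N {z \<in> space N. Q (F z)}"
        using B by (rule nn_integral_cmult_indicator)
      also have "emeasure N {z \<in> space N. Q (F z)} = emeasure M (Z -` {z \<in> space N. Q (F z)} \<inter> space M)"
        unfolding N_def by (rule emeasure_distr[OF Z]) (use B in \<open>simp add: sets_N N_def\<close>)
      also have "Z -` {z \<in> space N. Q (F z)} \<inter> space M = {\<omega> \<in> space M. Q {e \<in> H \<omega>. v \<notin> e}}"
        using measurable_space[OF Z] by (auto simp: FZ N_def)
      finally show ?thesis
        using r by (simp add: emeasure_eq_measure flip: ennreal_mult)
    qed
  qed (use r in auto)
qed

text \<open>This sentence refutes the zero-one law for \<open>a > 0\<close>. Edges have two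
  elements, so the case of equal values contributes nothing.\<close>

lemma nonempty_edges_sentence:
  assumes "simple_graph G"
  shows "G \<Turnstile> Ex 0 (Ex 1 (Adj 0 1)) \<longleftrightarrow> snd G \<noteq> {}"
proof -
  have "G \<Turnstile> Ex 0 (Ex 1 (Adj 0 1)) \<longleftrightarrow> (\<exists>u\<in>fst G. \<exists>v\<in>fst G. {u, v} \<in> snd G)"
    by (simp add: models_def)
  also have "\<dots> \<longleftrightarrow> snd G \<noteq> {}"
  proof
    assume "snd G \<noteq> {}"
    then obtain e where e: "e \<in> snd G" by blast
    then have "card e = 2" "e \<subseteq> fst G" using assms by (auto simp: simple_graph_def)
    then obtain u v where "e = {u, v}" by (auto simp: card_2_iff)
    then show "\<exists>u\<in>fst G. \<exists>v\<in>fst G. {u, v} \<in> snd G" using e \<open>e \<subseteq> fst G\<close> by blast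
  qed blast
  finally show ?thesis .
qed

section \<open>The limit law and its consequences for the zero-one law\<close>

theorem theorem1p3:
  fixes D :: nat and r :: "nat \<Rightarrow> real" and a :: real
    and M :: "nat \<Rightarrow> 'w measure" and X :: "nat \<Rightarrow> nat \<Rightarrow> 'w \<Rightarrow> (nat \<Rightarrow> circle)"
  defines "G \<equiv> \<lambda>n \<omega>. geometric_graph D n (r n) (\<lambda>i. X n i \<omega>)"
    and "lam \<equiv> 2 ^ (D - 1) * a"
  assumes "D \<ge> 1"
    and "\<And>n. r n \<in> {0..1/2}"
    and "a \<ge> 0"
    and "(\<lambda>n. (real n)\<^sup>2 * r n ^ D) \<longlonglongrightarrow> a"
    and "\<And>n. prob_space (M n)"
    and "\<And>n. prob_space.indep_vars (M n) (\<lambda>_. torus_uniform D) (X n) {1..n}"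
    and "\<And>n i. i \<in> {1..n} \<Longrightarrow> distr (M n) (torus_uniform D) (X n i) = torus_uniform D"
  shows "(\<forall>\<phi>. sentence \<phi> \<longrightarrow>
            convergent (\<lambda>n. graph_prob (M n) (G n) \<phi>) \<and>
            (\<forall>j. (\<forall>\<^sub>F N in sequentially. matching_graph j N \<Turnstile> \<phi>) \<or>
                 (\<forall>\<^sub>F N in sequentially. \<not> matching_graph j N \<Turnstile> \<phi>)) \<and>
            (\<lambda>j. exp (- lam) * lam ^ j / fact j * eventual_truth \<phi> j)
              sums lim (\<lambda>n. graph_prob (M n) (G n) \<phi>)) \<and>
         (a = 0 \<longrightarrow>
            (\<lambda>n. measure (M n) {\<omega> \<in> space (M n). snd (G n \<omega>) = {}}) \<longlonglongrightarrow> 1 \<and>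
            zero_one_law M G) \<and>
         (a > 0 \<longrightarrow> \<not> zero_one_law M G)"
proof -
  interpret prob_space "M n" for n by fact
  define H where "H n \<omega> = snd (geometric_graph D n (r n) (\<lambda>i. X n i \<omega>))" for n \<omega>
  define p where "p n = (2 * r n) ^ D" for n
  have r: "0 \<le> r n" "r n \<le> 1 / 2" for n using assms(4)[of n] by auto
  interpret R: random_edge_set "M n" "{1..n}" "H n" "p n" for n
    unfolding H_def p_def
    by (rule random_edge_set_geometric_graph) (use assms r in auto)
  have G: "G n \<omega> = ({1..n}, H n \<omega>)" for n \<omega>
    by (simp add: G_def H_def geometric_graph_def)
  define K where "K n = real (card (R.all_edges n))" for n
  define m where "m n = K n * p n" for n
  define q where "q n j = measure (M n) {\<omega> \<in> space (M n). card (H n \<omega>) = j}" for n j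
  have K: "K n = real n * (real n - 1) / 2" for n
  proof -
    have "2 * (n choose 2) = n * (n - 1)" by (cases n) (simp_all add: choose_two)
    then have "2 * real (n choose 2) = real n * real (n - 1)" by (metis of_nat_mult of_nat_numeral)
    then show ?thesis unfolding K_def R.card_all_edges by (cases n) auto
  qed
  \<comment> \<open>One factor 2 cancels the denominator of the binomial coefficient, hence the
    exponent \<open>D - 1\<close> in \<open>lam\<close>.\<close>
  have two_D: "(2::real) ^ D = 2 * 2 ^ (D - 1)" using assms(3) by (cases D) auto
  have lam: "lam \<ge> 0" using assms(5) by (simp add: lam_def)
  have inv_n: "(\<lambda>n. 1 / real n) \<longlonglongrightarrow> 0" by (rule lim_1_over_n)
  have m_lim: "m \<longlonglongrightarrow> lam"
  proof -
    have "(\<lambda>n. 2 ^ (D - 1) * ((real n)\<^sup>2 * r n ^ D) * (1 - 1 / real n)) \<longlonglongrightarrow> 2 ^ (D - 1) * a * (1 - 0)"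
      by (intro tendsto_intros assms(6) inv_n)
    moreover have "2 ^ (D - 1) * ((real n)\<^sup>2 * r n ^ D) * (1 - 1 / real n) = m n" for n
      by (cases "n = 0") (simp_all add: m_def K p_def power_mult_distrib two_D power2_eq_square field_simps)
    ultimately show ?thesis by (simp add: lam_def)
  qed
  have np_lim: "(\<lambda>n. real n * p n) \<longlonglongrightarrow> 0"
  proof -
    have "(\<lambda>n. 2 ^ D * ((real n)\<^sup>2 * r n ^ D) * (1 / real n)) \<longlonglongrightarrow> 2 ^ D * a * 0"
      by (intro tendsto_intros assms(6) inv_n)
    moreover have "2 ^ D * ((real n)\<^sup>2 * r n ^ D) * (1 / real n) = real n * p n" for n
      by (cases "n = 0") (simp_all add: p_def power_mult_distrib power2_eq_square)
    ultimately show ?thesis by simp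
  qed
  \<comment> \<open>Both error terms, \<open>K n * (2 * n * p\<^sup>2)\<close> for meeting edges and
    \<open>K n * (4 * n * p\<^sup>2)\<close> in the recurrence, have this form.\<close>
  have err_lim: "(\<lambda>n. c * m n * (real n * p n)) \<longlonglongrightarrow> 0" for c
  proof -
    have "(\<lambda>n. c * m n * (real n * p n)) \<longlonglongrightarrow> c * lam * 0"
      by (intro tendsto_intros m_lim np_lim)
    then show ?thesis by simp
  qed
  define \<pi> where "\<pi> j = exp (- lam) * lam ^ j / fact j" for j
  have q_lim: "(\<lambda>n. q n j) \<longlonglongrightarrow> \<pi> j" for j
    unfolding \<pi>_def
  proof (rule poisson_limit)
    show "0 \<le> q n j" "q n j \<le> 1" for n j by (simp_all add: q_def)
    show "m \<longlonglongrightarrow> lam" "0 \<le> lam" by fact+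
    show "(\<lambda>n. real (Suc j) * q n (Suc j) - m n * q n j) \<longlonglongrightarrow> 0" for j
    proof (rule Lim_null_comparison[OF always_eventually err_lim[of 4]], rule allI)
      fix n
      show "norm (real (Suc j) * q n (Suc j) - m n * q n j) \<le> 4 * m n * (real n * p n)"
        using R.card_recurrence[of j n]
        by (simp add: q_def m_def K_def power2_eq_square mult_ac del: of_nat_Suc)
    qed
    show "\<bar>1 - (\<Sum>j\<le>J. q n j)\<bar> \<le> m n / real (Suc J)" for n J
    proof -
      have "1 - (\<Sum>j\<le>J. q n j) = measure (M n) {\<omega> \<in> space (M n). J < card (H n \<omega>)}"
        unfolding q_def by (rule R.pr_card_gt[symmetric])
      then show ?thesis using R.pr_card_gt_le[of n J] by (simp add: m_def K_def)
    qed
  qed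
  have \<pi>_summable: "summable \<pi>"
    using summable_mult[OF summable_exp[of lam], of "exp (- lam)"]
    by (simp add: \<pi>_def[abs_def] field_simps)
  have \<pi>_nonneg: "0 \<le> \<pi> j" for j using lam by (simp add: \<pi>_def)
  have truth_01: "eventual_truth \<phi> j \<in> {0, 1}" for \<phi> j by (simp add: eventual_truth_def)
  have summable: "summable (\<lambda>j. \<pi> j * eventual_truth \<phi> j)" for \<phi>
    by (rule summable_comparison_test'[OF \<pi>_summable, of 0])
      (simp add: eventual_truth_def abs_mult \<pi>_nonneg)
  have prob_lim: "(\<lambda>n. graph_prob (M n) (G n) \<phi>) \<longlonglongrightarrow> (\<Sum>j. \<pi> j * eventual_truth \<phi> j)"
    if \<phi>: "sentence \<phi>" for \<phi>
  proof (rule tendsto_of_approximations)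
    show "(\<lambda>n. \<Sum>j\<le>J. q n j * eventual_truth \<phi> j) \<longlonglongrightarrow> (\<Sum>j\<le>J. \<pi> j * eventual_truth \<phi> j)" for J
      by (intro tendsto_intros q_lim)
    show "(\<lambda>J. \<Sum>j\<le>J. \<pi> j * eventual_truth \<phi> j) \<longlonglongrightarrow> (\<Sum>j. \<pi> j * eventual_truth \<phi> j)"
      by (rule summable_LIMSEQ'[OF summable])
    show "(\<lambda>n. 2 * m n * (real n * p n) + m n / real (Suc J)) \<longlonglongrightarrow> lam / real (Suc J)" for J
      using tendsto_add[OF err_lim[of 2] tendsto_divide[OF m_lim tendsto_const[of "real (Suc J)"]]] by simp
    show "(\<lambda>J. lam / real (Suc J)) \<longlonglongrightarrow> 0"
      using tendsto_mult_left[OF LIMSEQ_inverse_real_of_nat, of lam] by (simp add: divide_inverse)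
    show "\<forall>\<^sub>F n in sequentially. \<bar>graph_prob (M n) (G n) \<phi> - (\<Sum>j\<le>J. q n j * eventual_truth \<phi> j)\<bar>
        \<le> 2 * m n * (real n * p n) + m n / real (Suc J)" for J
      \<comment> \<open>At most \<open>J\<close> disjoint edges then leave at least
        \<open>quantifier_rank \<phi>\<close> isolated vertices.\<close>
      using eventually_ge_at_top[of "2 * J + quantifier_rank \<phi>"]
    proof eventually_elim
      case (elim n)
      have "({1..n}, S) \<Turnstile> \<phi> \<longleftrightarrow> eventual_truth \<phi> (card S) = 1"
        if S: "S \<subseteq> R.all_edges n" "pairwise disjnt S" "card S \<le> J" for S
      proof -
        have "({1..n}, S) \<Turnstile> \<phi> \<longleftrightarrow> matching_graph (card S) (card {1..n} - 2 * card S) \<Turnstile> \<phi>"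
          using S unfolding R.all_edges_def by (intro models_matching \<phi>) auto
        then show ?thesis
          using elim S(3) eventual_truth_eq[OF \<phi>, of "n - 2 * card S"] by simp
      qed
      from R.pr_approx[of n J "\<lambda>S. ({1..n}, S) \<Turnstile> \<phi>" "\<lambda>j. eventual_truth \<phi> j = 1", OF this]
      have "\<bar>graph_prob (M n) (G n) \<phi> - (\<Sum>j\<le>J. q n j * of_bool (eventual_truth \<phi> j = 1))\<bar>
          \<le> 2 * m n * (real n * p n) + m n / real (Suc J)"
        by (simp add: graph_prob_def G q_def m_def K_def power2_eq_square mult_ac del: of_nat_Suc)
      moreover have "of_bool (eventual_truth \<phi> j = 1) = eventual_truth \<phi> j" for j
        by (simp add: eventual_truth_def)
      ultimately show ?case by simp
    qed
  qed
  \<comment> \<open>Finiteness matters because an infinite set also has \<open>card\<close> equal to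
    0.\<close>
  have no_edges: "snd (G n \<omega>) = {} \<longleftrightarrow> card (H n \<omega>) = 0" for n \<omega>
    using finite_subset[OF R.H_Pow[unfolded Pow_iff] R.finite_all_edges] by (simp add: G)
  have zero_one: "zero_one_law M G" if "a = 0"
    unfolding zero_one_law_def
  proof (intro allI impI)
    fix \<phi> assume \<phi>: "sentence \<phi>"
    \<comment> \<open>With \<open>lam = 0\<close> the Poisson weights are concentrated at 0, where
      \<open>0 ^ 0 = 1\<close>.\<close>
    have "(\<Sum>j. \<pi> j * eventual_truth \<phi> j) = (\<Sum>j\<in>{0}. \<pi> j * eventual_truth \<phi> j)"
      by (rule suminf_finite) (use that in \<open>auto simp: \<pi>_def lam_def\<close>)
    also have "\<dots> = eventual_truth \<phi> 0" using that by (simp add: \<pi>_def lam_def)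
    finally show "(\<lambda>n. graph_prob (M n) (G n) \<phi>) \<longlonglongrightarrow> 0 \<or> (\<lambda>n. graph_prob (M n) (G n) \<phi>) \<longlonglongrightarrow> 1"
      using prob_lim[OF \<phi>] truth_01[of \<phi> 0] by auto
  qed
  have not_zero_one: "\<not> zero_one_law M G" if "a > 0"
  proof
    assume "zero_one_law M G"
    define \<phi> where "\<phi> = Ex 0 (Ex 1 (Adj 0 1))"
    have "sentence \<phi>" by (auto simp: sentence_def \<phi>_def)
    have "graph_prob (M n) (G n) \<phi> = 1 - q n 0" for n
    proof -
      have "G n \<omega> \<Turnstile> \<phi> \<longleftrightarrow> snd (G n \<omega>) \<noteq> {}" for \<omega>
        unfolding \<phi>_def G_def by (rule nonempty_edges_sentence[OF simple_graph_geometric_graph])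
      then have "graph_prob (M n) (G n) \<phi> = measure (M n) {\<omega> \<in> space (M n). \<not> card (H n \<omega>) = 0}"
        by (simp only: graph_prob_def no_edges)
      then show ?thesis
        using prob_neg[OF R.event[of n "\<lambda>S. card S = 0"]] by (simp add: q_def)
    qed
    then have lim: "(\<lambda>n. graph_prob (M n) (G n) \<phi>) \<longlonglongrightarrow> 1 - \<pi> 0"
      using tendsto_diff[OF tendsto_const[of 1] q_lim[of 0]] by simp
    have "(\<lambda>n. graph_prob (M n) (G n) \<phi>) \<longlonglongrightarrow> 0 \<or> (\<lambda>n. graph_prob (M n) (G n) \<phi>) \<longlonglongrightarrow> 1"
      using \<open>zero_one_law M G\<close> \<open>sentence \<phi>\<close> by (simp add: zero_one_law_def)
    \<comment> \<open>Here \<open>\<pi> 0 = exp (- lam)\<close> lies strictly between 0 and 1 since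
      \<open>lam > 0\<close>.\<close>
    then have "1 - \<pi> 0 = 0 \<or> 1 - \<pi> 0 = 1" using LIMSEQ_unique[OF lim] by blast
    then show False using that by (simp add: \<pi>_def lam_def)
  qed
  show ?thesis
  proof (intro conjI allI impI)
    fix \<phi> assume \<phi>: "sentence \<phi>"
    show "convergent (\<lambda>n. graph_prob (M n) (G n) \<phi>)" using prob_lim[OF \<phi>] by (rule convergentI)
    show "(\<forall>\<^sub>F N in sequentially. matching_graph j N \<Turnstile> \<phi>) \<or>
        (\<forall>\<^sub>F N in sequentially. \<not> matching_graph j N \<Turnstile> \<phi>)" for j
      by (rule eventually_matching_graph_const[OF \<phi>])
    show "(\<lambda>j. exp (- lam) * lam ^ j / fact j * eventual_truth \<phi> j) sums lim (\<lambda>n. graph_prob (M n) (G n) \<phi>)"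
      using summable_sums[OF summable[of \<phi>]] limI[OF prob_lim[OF \<phi>]] by (simp add: \<pi>_def)
  next
    assume "a = 0"
    then have "\<pi> 0 = 1" by (simp add: \<pi>_def lam_def)
    with q_lim[of 0] show "(\<lambda>n. measure (M n) {\<omega> \<in> space (M n). snd (G n \<omega>) = {}}) \<longlonglongrightarrow> 1"
      by (simp only: no_edges q_def)
  qed (rule zero_one not_zero_one, assumption)+
qed

end
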